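(* Let $\nu$ be a probability measure on $[-\pi,\pi]$ which is absolutely continuous with respect to Lebesgue measure, with probability density $p$ such that $p\in\mathcal{L}\cap\mathcal{A}$. Then for every $n\ge 1$ and every partition $\rho$ of $\{1,\dots,n\}$ the expansion coefficient $K_{\rho,\nu}$ exists. Moreover, if $\rho$ has $r$ blocks, then $$K_{\rho,\nu}=K_{\rho,u}\cdot(2\pi)^{r-1}\cdot\int_{-\pi}^{\pi}p(x)^r\,dx,$$ where $K_{\rho,u}$ is the expansion coefficient for the uniform distribution on $[-\pi,\pi]$.
   Context: $\mathcal{L}:=\bigcap_{q\ge1}L^q([-\pi,\pi])$ (functions that are $q$-integrable for every $q\ge 1$). $\mathcal{A}$ is the class of probability measures (equivalently densities) on $[-\pi,\pi]$ whose Fourier coefficients are all nonnegative: $\int_{-\pi}^{\pi}e^{-imt}p(t)\,dt\ge 0$ for all $m\in\mathbb{Z}$. For a probability measure $\nu$ on $[-\pi,\pi]$ let $a_\nu(m):=\int_{-\pi}^{\pi}e^{imx}\,d\nu(x)$, $m\in\mathbb{Z}$. Let $\rho=\{B_1,\dots,B_r\}$ be a partition of $\{1,\dots,n\}$. For $N\ge1$ and a multi-index $\mathbf{i}=(i_1,\dots,i_n)\in\{1,\dots,N\}^n$, set $i_0:=i_n$ and $E_b(\mathbf{i}):=\sum_{k\in B_b}(i_{k-1}-i_k)$ for $b=1,\dots,r$. Define $$K_{\rho,\nu,N}:=N^{r-n-1}\sum_{\mathbf{i}\in\{1,\dots,N\}^n}\prod_{b=1}^{r}a_\nu(E_b(\mathbf{i})),$$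 and the (Vandermonde) expansion coefficient $K_{\rho,\nu}:=\lim_{N\to\infty}K_{\rho,\nu,N}$ when the limit exists. (These are the coefficients appearing in $\lim_{N\to\infty}\mathbb{E}[\mathrm{tr}_L(({\bf V}^*{\bf V})^n)]=\sum_{\rho}K_{\rho,\nu}c^{|\rho|-1}$ for the $N\times L$ random Vandermonde matrix ${\bf V}$ with entries ${\bf V}_{k,l}=N^{-1/2}e^{-j(k-1)\theta_l}$, $\theta_l$ i.i.d. with law $\nu$, $L/N\to c$.) $K_{\rho,u}$ denotes $K_{\rho,\nu}$ for $\nu$ the uniform distribution on $[-\pi,\pi]$, for which $K_{\rho,u}=\lim_N N^{r-n-1}\#\{\mathbf{i}: E_b(\mathbf{i})=0\ \forall b\}$. *)

theory Defs
  imports "HOL-Analysis.Analysis" "HOL-Library.Complex_Order" "HOL-Library.Disjoint_Sets"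
begin

definition fcoef :: "(real \<Rightarrow> real) \<Rightarrow> int \<Rightarrow> complex" where
  "fcoef p m = (LINT x:{-pi..pi}|lborel. cis (real_of_int m * x) * complex_of_real (p x))"

definition prev_idx :: "nat \<Rightarrow> nat \<Rightarrow> nat" where
  "prev_idx n k = (if k = 1 then n else k - 1)"

definition Eblock :: "nat \<Rightarrow> nat set \<Rightarrow> (nat \<Rightarrow> nat) \<Rightarrow> int" where
  "Eblock n B i = (\<Sum>k\<in>B. int (i (prev_idx n k)) - int (i k))"

definition KN :: "(real \<Rightarrow> real) \<Rightarrow> nat \<Rightarrow> nat set set \<Rightarrow> nat \<Rightarrow> complex" where
  "KN p n \<rho> N = complex_of_real (real N powr (real (card \<rho>) - real n - 1)) *
     (\<Sum>i\<in>Pi\<^sub>E {1..n} (\<lambda>_. {1..N}). \<Prod>B\<in>\<rho>. fcoef p (Eblock n B i))"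

definition unif_density :: "real \<Rightarrow> real" where
  "unif_density x = 1 / (2 * pi)"

end

theory Submission
  imports Defs
begin

text \<open>
  Grouping the multi-indices by the vector \<open>m\<close> of their block sums writes \<open>K\<^sub>N\<close> as the sum, over all
  integer vectors \<open>m\<close> of total zero, of the normalised number \<open>w\<^sub>N m\<close> of multi-indices with block
  sums \<open>m\<close> times the product of the coefficients \<open>a (m B)\<close>. Solving the block equations for
  \<open>r - 1\<close> of the indices turns \<open>w\<^sub>N m\<close> into a lattice point density in the unit cube: it lies in
  \<open>[0, 1]\<close> and tends to the volume of a polytope, which does not depend on \<open>m\<close> since \<open>m\<close> only
  shifts the inequalities by \<open>O(1)\<close>. As \<open>a\<close> is nonnegative, dominated convergence reduces the claim to
  summing the products \<open>\<Prod>B. a (m B)\<close>. This sum is an iterated convolution of \<open>a\<close> at \<open>0\<close>, which by Parseval's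
  identity, applied to \<open>p\<close> and the powers of \<open>p\<close>, equals \<open>(2\<pi>)\<^bsup>r-1\<^esup> \<integral>p\<^sup>r\<close>.
\<close>

section \<open>Parseval's identity on a period\<close>

text \<open>Membership in every L^q does not bound p, so no pointwise convergence of its Fourier
  series is used. Integrability of all powers makes each p^k square integrable, and Parseval for the
  product p * p^k is exactly what one convolution step needs.

  Nonnegativity of the coefficients does more than give a majorant: it upgrades the symmetric
  partial sums delivered by Parseval to unconditional sums, and it lets iterated sums be merged into
  sums over vectors. It passes from p to its powers because convolution preserves it.

  The coefficients carry no factor 1/(2 pi), so each convolution with a yields 2 pi times the
  coefficients of the next power, and r factors need r - 1 convolutions. For the uniform law a is
  the indicator of 0 and the sum over m is 1; hence the polytope volume is itself the uniform
  coefficient and never has to be computed.\<close>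

definition period :: "real measure" where
  "period = restrict_space lborel {-pi..pi}"

definition square_integrable :: "(real \<Rightarrow> complex) \<Rightarrow> bool" where
  "square_integrable f \<longleftrightarrow> f \<in> borel_measurable period \<and> integrable period (\<lambda>x. (norm (f x))\<^sup>2)"

definition norm2 :: "(real \<Rightarrow> complex) \<Rightarrow> real" where
  "norm2 f = sqrt (LINT x|period. (norm (f x))\<^sup>2)"

text \<open>Sign and normalisation are those of \<open>fcoef\<close>: e^(imx) without 1/(2 pi). This
  is the origin of the constants 2 pi in Bessel, Parseval and every convolution.\<close>

definition fourier :: "(real \<Rightarrow> complex) \<Rightarrow> int \<Rightarrow> complex" where
  "fourier f m = (LINT x|period. cis (real_of_int m * x) * f x)"

lemma space_period [simp]: "space period = {-pi..pi}"
  by (simp add: period_def space_restrict_space)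

lemma finite_measure_period: "finite_measure period"
  by (rule finite_measureI) (auto simp: period_def emeasure_restrict_space space_restrict_space)

lemma borel_measurable_period: "f \<in> borel_measurable borel \<Longrightarrow> f \<in> borel_measurable period"
  by (auto simp: period_def intro!: measurable_restrict_space1)

lemma borel_measurable_cis [measurable]: "(\<lambda>x. cis (c * x)) \<in> borel_measurable period"
  by (intro borel_measurable_period borel_measurable_continuous_onI continuous_intros)

lemma set_lebesgue_integral_period:
  fixes f :: "real \<Rightarrow> 'a::{banach, second_countable_topology}"
  shows "(LINT x:{-pi..pi}|lborel. f x) = (LINT x|period. f x)"
  by (simp add: period_def integral_restrict_space set_lebesgue_integral_def)

lemma set_integrable_period:
  fixes f :: "real \<Rightarrow> 'a::{banach, second_countable_topology}"
  shows "set_integrable lborel {-pi..pi} f \<longleftrightarrow> integrable period f"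
  by (simp add: period_def integrable_restrict_space set_integrable_def)

lemma integrable_period_bounded:
  fixes f :: "real \<Rightarrow> 'a::{banach, second_countable_topology}"
  assumes "f \<in> borel_measurable period" "\<And>x. norm (f x) \<le> B"
  shows "integrable period f"
  using finite_measure.integrable_const_bound[OF finite_measure_period, of f B] assms by auto

lemma integral_cis: "(LINT x|period. cis (real_of_int m * x)) = (if m = 0 then 2 * pi else 0)"
proof (cases "m = 0")
  case True
  have "measure period {-pi..pi} = 2 * pi"
    by (simp add: period_def measure_restrict_space)
  then show ?thesis using True by (simp add: measure_def scaleR_conv_of_real)
next
  case False
  define F where "F x = cis (real_of_int m * x) / (\<i> * of_int m)" for x
  have "(F has_vector_derivative cis (real_of_int m * x)) (at x within {-pi..pi})" for x
    unfolding F_def has_vector_derivative_def using False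
    by (auto intro!: derivative_eq_intros simp: fun_eq_iff scaleR_conv_of_real field_simps)
  then have "((\<lambda>x. cis (real_of_int m * x)) has_integral F pi - F (-pi)) {-pi..pi}"
    by (intro fundamental_theorem_of_calculus) auto
  moreover have "F pi = F (-pi)"
  proof -
    have "cis (real_of_int m * pi) = cis (real_of_int m * (-pi))"
      using sin_npi_int[of m] by (simp add: complex_eq_iff mult.commute)
    then show ?thesis by (simp only: F_def)
  qed
  moreover have "set_integrable lborel {-pi..pi} (\<lambda>x. cis (real_of_int m * x))"
    by (auto simp: set_integrable_period intro!: integrable_period_bounded[where B = 1])
  ultimately show ?thesis
    using set_borel_integral_eq_integral(2)[of "{-pi..pi}" "\<lambda>x. cis (real_of_int m * x)"] False
    by (simp add: set_lebesgue_integral_period integral_unique)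
qed

section \<open>Square-integrable functions on the period and the Cauchy-Schwarz inequality\<close>

lemma square_integrable_measurable:
  "square_integrable f \<Longrightarrow> f \<in> borel_measurable period"
  by (simp add: square_integrable_def)

lemma square_integrable_dominated:
  assumes "square_integrable g" "f \<in> borel_measurable period"
    "\<And>x. x \<in> {-pi..pi} \<Longrightarrow> norm (f x) \<le> norm (g x)"
  shows "square_integrable f"
  using assms unfolding square_integrable_def
  by - (rule conjI, simp, rule Bochner_Integration.integrable_bound[where f = "\<lambda>x. (norm (g x))\<^sup>2"],
    auto intro!: power_mono)

lemma square_integrable_bounded:
  assumes "f \<in> borel_measurable period" "\<And>x. norm (f x) \<le> B"
  shows "square_integrable f"
  unfolding square_integrable_def using assms
  by (auto intro!: integrable_period_bounded[where B = "B\<^sup>2"] power_mono)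

lemma square_integrable_cmult:
  "square_integrable f \<Longrightarrow> square_integrable (\<lambda>x. c * f x)"
  unfolding square_integrable_def by (auto simp: norm_mult power_mult_distrib)

lemma square_integrable_cis_mult:
  "square_integrable f \<Longrightarrow> square_integrable (\<lambda>x. cis (a * x) * f x)"
  unfolding square_integrable_def by (auto simp: norm_mult)

lemma square_integrable_add:
  assumes "square_integrable f" "square_integrable g"
  shows "square_integrable (\<lambda>x. f x + g x)"
proof -
  have "(norm (f x + g x))\<^sup>2 \<le> 2 * (norm (f x))\<^sup>2 + 2 * (norm (g x))\<^sup>2" for x
  proof -
    have "(norm (f x + g x))\<^sup>2 \<le> (norm (f x) + norm (g x))\<^sup>2"
      by (intro power_mono norm_triangle_ineq) auto
    also have "\<dots> \<le> 2 * (norm (f x))\<^sup>2 + 2 * (norm (g x))\<^sup>2"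
      using sum_squares_bound[of "norm (f x)" "norm (g x)"] by (simp add: power2_sum)
    finally show ?thesis .
  qed
  moreover have "integrable period (\<lambda>x. 2 * (norm (f x))\<^sup>2 + 2 * (norm (g x))\<^sup>2)"
    using assms by (auto simp: square_integrable_def)
  ultimately have "integrable period (\<lambda>x. (norm (f x + g x))\<^sup>2)"
    using assms
    by - (rule Bochner_Integration.integrable_bound[where f = "\<lambda>x. 2 * (norm (f x))\<^sup>2 + 2 * (norm (g x))\<^sup>2"],
      auto simp: square_integrable_def)
  then show ?thesis
    using assms by (auto simp: square_integrable_def)
qed

lemma square_integrable_diff:
  assumes "square_integrable f" "square_integrable g"
  shows "square_integrable (\<lambda>x. f x - g x)"
  using square_integrable_add[OF assms(1) square_integrable_cmult[OF assms(2), of "-1"]] by simp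

lemma square_integrable_sum:
  "(\<And>j. j \<in> J \<Longrightarrow> square_integrable (f j)) \<Longrightarrow> square_integrable (\<lambda>x. \<Sum>j\<in>J. f j x)"
  by (induction J rule: infinite_finite_induct)
    (auto intro!: square_integrable_add simp: square_integrable_bounded[where B = 0])

lemma square_integrable_cis: "square_integrable (\<lambda>x. cis (a * x))"
  by (rule square_integrable_bounded[where B = 1]) auto

lemma integrable_mult_square_integrable:
  assumes "square_integrable f" "square_integrable g"
  shows "integrable period (\<lambda>x. f x * g x)"
proof -
  have "norm (f x * g x) \<le> (norm (f x))\<^sup>2 + (norm (g x))\<^sup>2" for x
  proof -
    have "0 \<le> norm (f x) * norm (g x)" by simp
    then show ?thesis
      using sum_squares_bound[of "norm (f x)" "norm (g x)"] unfolding norm_mult by linarith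
  qed
  then show ?thesis
    using assms
    by - (rule Bochner_Integration.integrable_bound[where f = "\<lambda>x. (norm (f x))\<^sup>2 + (norm (g x))\<^sup>2"],
      auto simp: square_integrable_def)
qed

lemma integrable_cis_mult:
  "square_integrable f \<Longrightarrow> integrable period (\<lambda>x. cis (a * x) * f x)"
  using integrable_mult_square_integrable[OF square_integrable_cis] .

lemma norm2_nonneg: "norm2 f \<ge> 0"
  by (simp add: norm2_def)

lemma norm2_squared: "(norm2 f)\<^sup>2 = (LINT x|period. (norm (f x))\<^sup>2)"
  by (simp add: norm2_def)

text \<open>Cauchy-Schwarz for nonnegative extended integrals, applied to the moduli; integrability
  of the product allows the return to Bochner integrals.\<close>

lemma norm_integral_mult_le:
  assumes f: "square_integrable f" and g: "square_integrable g"
  shows "norm (LINT x|period. f x * g x) \<le> norm2 f * norm2 g"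
proof -
  note [measurable] = f[THEN square_integrable_measurable] g[THEN square_integrable_measurable]
  have int: "integrable period (\<lambda>x. norm (f x) * norm (g x))"
    using integrable_norm[OF integrable_mult_square_integrable[OF f g]] by (simp add: norm_mult)
  let ?I = "LINT x|period. norm (f x) * norm (g x)"
  have "ennreal (?I\<^sup>2) = (\<integral>\<^sup>+x. ennreal (norm (f x)) * ennreal (norm (g x)) \<partial>period)\<^sup>2"
    using int by (simp add: nn_integral_eq_integral ennreal_mult[symmetric] ennreal_power)
  also have "\<dots> \<le> (\<integral>\<^sup>+x. (ennreal (norm (f x)))\<^sup>2 \<partial>period) * (\<integral>\<^sup>+x. (ennreal (norm (g x)))\<^sup>2 \<partial>period)"
    by (intro Cauchy_Schwarz_nn_integral) auto
  also have "\<dots> = ennreal ((norm2 f)\<^sup>2 * (norm2 g)\<^sup>2)"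
    using f g by (simp add: ennreal_power nn_integral_eq_integral square_integrable_def norm2_squared ennreal_mult)
  finally have "?I\<^sup>2 \<le> (norm2 f * norm2 g)\<^sup>2"
    by (simp add: power_mult_distrib)
  then have "?I \<le> norm2 f * norm2 g"
    by (rule power2_le_imp_le) (simp add: norm2_nonneg)
  moreover have "norm (LINT x|period. f x * g x) \<le> ?I"
    using integral_norm_bound[of period "\<lambda>x. f x * g x"] by (simp add: norm_mult)
  ultimately show ?thesis by simp
qed

section \<open>Fourier coefficients and Bessel's inequality\<close>

lemma fourier_add:
  "square_integrable f \<Longrightarrow> square_integrable g \<Longrightarrow> fourier (\<lambda>x. f x + g x) m = fourier f m + fourier g m"
  by (simp add: fourier_def distrib_left integrable_cis_mult)

lemma fourier_diff:
  "square_integrable f \<Longrightarrow> square_integrable g \<Longrightarrow> fourier (\<lambda>x. f x - g x) m = fourier f m - fourier g m"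
  by (simp add: fourier_def right_diff_distrib integrable_cis_mult)

lemma fourier_cmult:
  "fourier (\<lambda>x. c * f x) m = c * fourier f m"
  by (simp add: fourier_def mult.left_commute)

lemma fourier_cis_mult: "fourier (\<lambda>x. cis (real_of_int k * x) * f x) m = fourier f (m + k)"
  by (simp add: fourier_def cis_mult mult.assoc[symmetric] distrib_right)

lemma fourier_cis: "fourier (\<lambda>x. cis (real_of_int k * x)) m = (if m = - k then 2 * pi else 0)"
  using integral_cis[of "m + k"]
  by (auto simp: fourier_def cis_mult distrib_right add_eq_0_iff2)

text \<open>The squared distance from \<open>u\<close> to its orthogonal projection \<open>S\<close>
  onto finitely many characters is nonnegative; expanded, it is the squared norm of \<open>u\<close>
  minus that of \<open>S\<close>.\<close>

lemma Bessel_inequality: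
  assumes u: "square_integrable u" and J: "finite J"
  shows "(\<Sum>j\<in>J. (norm (fourier u j))\<^sup>2) \<le> 2 * pi * (norm2 u)\<^sup>2"
proof -
  \<comment> \<open>\<open>fourier u j\<close> integrates against cis (j x), so it is the
    coefficient along the conjugate character cis (-j x); 2 pi is the squared norm of a
    character.\<close>
  define S where "S x = (\<Sum>j\<in>J. fourier u j / (2 * pi) * cis (real_of_int (-j) * x))" for x
  have S: "square_integrable S"
    unfolding S_def by (intro square_integrable_sum square_integrable_cmult square_integrable_cis)
  have cnj: "square_integrable (\<lambda>x. cnj (f x))" if "square_integrable f" for f
    using that by (auto simp: square_integrable_def intro!: borel_measurable_continuous_on[of cnj] continuous_intros)
  have cnjS: "cnj (S x) = (\<Sum>j\<in>J. cnj (fourier u j) / (2 * pi) * cis (real_of_int j * x))" for x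
    by (simp add: S_def cis_cnj)
  \<comment> \<open>Used with \<open>v\<close> equal to \<open>u\<close> and to \<open>S\<close>:
    both inner products are \<open>?B / (2 * pi)\<close>, so the mixed terms collapse to a single
    -\<open>?B / (2 * pi)\<close>.\<close>
  have against_S: "(LINT x|period. v x * cnj (S x)) = (\<Sum>j\<in>J. cnj (fourier u j) * fourier v j) / (2 * pi)"
    if v: "square_integrable v" for v
  proof -
    have "(LINT x|period. v x * cnj (S x))
        = (LINT x|period. (\<Sum>j\<in>J. cnj (fourier u j) / (2 * pi) * (cis (real_of_int j * x) * v x)))"
      by (simp add: cnjS sum_distrib_left mult_ac)
    also have "\<dots> = (\<Sum>j\<in>J. cnj (fourier u j) / (2 * pi) * fourier v j)"
      using v by (subst Bochner_Integration.integral_sum) (auto simp: fourier_def integrable_cis_mult)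
    finally show ?thesis by (simp add: sum_divide_distrib)
  qed
  let ?B = "\<Sum>j\<in>J. (norm (fourier u j))\<^sup>2"
  have sq: "cnj z * z = complex_of_real ((norm z)\<^sup>2)" for z :: complex
    by (metis complex_norm_square mult.commute)
  have uS: "(LINT x|period. u x * cnj (S x)) = complex_of_real (?B / (2 * pi))"
    by (simp add: against_S[OF u] sq)
  have fS: "fourier S k = fourier u k" if "k \<in> J" for k
  proof -
    have "fourier S k = (\<Sum>j\<in>J. fourier (\<lambda>x. fourier u j / (2 * pi) * cis (real_of_int (-j) * x)) k)"
      unfolding fourier_def S_def sum_distrib_left
      by (intro Bochner_Integration.integral_sum integrable_cis_mult square_integrable_cmult square_integrable_cis)
    also have "\<dots> = (\<Sum>j\<in>J. if k = j then fourier u j else 0)"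
      by (intro sum.cong refl) (simp only: fourier_cmult fourier_cis, simp)
    finally show ?thesis using J that by simp
  qed
  have SS: "(LINT x|period. S x * cnj (S x)) = complex_of_real (?B / (2 * pi))"
    by (simp add: against_S[OF S] fS sq)
  have pt: "(norm (u x - S x))\<^sup>2 = (norm (u x))\<^sup>2 - 2 * Re (u x * cnj (S x)) + Re (S x * cnj (S x))" for x
    unfolding cmod_power2 by (simp add: algebra_simps power2_eq_square)
  have "0 \<le> (LINT x|period. (norm (u x - S x))\<^sup>2)"
    by (rule Bochner_Integration.integral_nonneg) simp
  also have "\<dots> = (norm2 u)\<^sup>2 - 2 * Re (LINT x|period. u x * cnj (S x)) + Re (LINT x|period. S x * cnj (S x))"
    unfolding pt norm2_squared
    using u integrable_mult_square_integrable[OF u cnj[OF S]] integrable_mult_square_integrable[OF S cnj[OF S]]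
    by (subst Bochner_Integration.integral_add Bochner_Integration.integral_diff
        | simp add: square_integrable_def del: times_complex.sel)+
  also have "\<dots> = (norm2 u)\<^sup>2 - ?B / (2 * pi)"
    by (simp add: uS SS)
  finally have "?B / (2 * pi) \<le> (norm2 u)\<^sup>2" by simp
  then show ?thesis by (simp add: pos_divide_le_eq mult.commute)
qed

text \<open>Pairing j with -j replaces conjugation: the form is bilinear and approximates the
  integral of f * h itself, which suits products of powers of p.\<close>

definition fourier_pairing :: "(real \<Rightarrow> complex) \<Rightarrow> (real \<Rightarrow> complex) \<Rightarrow> nat \<Rightarrow> complex" where
  "fourier_pairing h f M = (\<Sum>j\<in>{-int M..int M}. fourier f j * fourier h (-j))"

text \<open>Cauchy-Schwarz for finite sums, then Bessel on both factors. The bound is uniform in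
  \<open>M\<close>, which is what makes Parseval stable under L^2 limits.\<close>

lemma norm_fourier_pairing_le:
  assumes f: "square_integrable f" and h: "square_integrable h"
  shows "norm (fourier_pairing h f M) \<le> 2 * pi * (norm2 f * norm2 h)"
proof -
  let ?J = "{-int M..int M}"
  have eq: "(\<Sum>j\<in>?J. (norm (fourier h (-j)))\<^sup>2) = (\<Sum>j\<in>?J. (norm (fourier h j))\<^sup>2)"
    by (rule sum.reindex_bij_witness[of _ uminus uminus]) auto
  have "norm (fourier_pairing h f M) \<le> (\<Sum>j\<in>?J. \<bar>norm (fourier f j)\<bar> * \<bar>norm (fourier h (-j))\<bar>)"
    unfolding fourier_pairing_def by (rule order.trans[OF norm_sum]) (simp add: norm_mult)
  also have "\<dots> \<le> L2_set (\<lambda>j. norm (fourier f j)) ?J * L2_set (\<lambda>j. norm (fourier h (-j))) ?J"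
    by (rule L2_set_mult_ineq)
  also have "\<dots> \<le> sqrt (2 * pi * (norm2 f)\<^sup>2) * sqrt (2 * pi * (norm2 h)\<^sup>2)"
    unfolding L2_set_def eq using Bessel_inequality[OF f, of ?J] Bessel_inequality[OF h, of ?J]
    by (intro mult_mono real_sqrt_le_mono) (auto intro: sum_nonneg)
  also have "\<dots> = 2 * pi * (norm2 f * norm2 h)"
    by (simp add: norm2_nonneg flip: real_sqrt_mult) (simp add: real_sqrt_mult norm2_nonneg power2_eq_square)
  finally show ?thesis .
qed

text \<open>For fixed \<open>h\<close> the functions \<open>f\<close> satisfying Parseval's identity form a linear space which, by
  Bessel's inequality, is closed in \<open>L\<^sup>2\<close>. It contains the trigonometric polynomials, hence by
  Stone--Weierstrass all \<open>g \<circ> cis\<close> with \<open>g\<close> continuous, then all indicators of Borel sets of the circle.\<close>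

definition parseval :: "(real \<Rightarrow> complex) \<Rightarrow> (real \<Rightarrow> complex) \<Rightarrow> bool" where
  "parseval h f \<longleftrightarrow> square_integrable f \<and>
     fourier_pairing h f \<longlonglongrightarrow> 2 * complex_of_real pi * (LINT x|period. f x * h x)"

lemma parseval_add:
  assumes h: "square_integrable h" and f: "parseval h f" and g: "parseval h g"
  shows "parseval h (\<lambda>x. f x + g x)"
proof -
  have sq: "square_integrable f" "square_integrable g"
    using f g by (auto simp: parseval_def)
  have "fourier_pairing h (\<lambda>x. f x + g x) = (\<lambda>M. fourier_pairing h f M + fourier_pairing h g M)"
    by (simp add: fun_eq_iff fourier_pairing_def fourier_add sq distrib_right sum.distrib)
  moreover have "(LINT x|period. (f x + g x) * h x) = (LINT x|period. f x * h x) + (LINT x|period. g x * h x)"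
    using sq h by (simp add: distrib_right integrable_mult_square_integrable)
  ultimately show ?thesis
    using tendsto_add[OF conjunct2[OF f[unfolded parseval_def]] conjunct2[OF g[unfolded parseval_def]]]
    by (simp add: parseval_def square_integrable_add sq distrib_left)
qed

lemma parseval_cmult:
  assumes f: "parseval h f"
  shows "parseval h (\<lambda>x. c * f x)"
proof -
  have "fourier_pairing h (\<lambda>x. c * f x) = (\<lambda>M. c * fourier_pairing h f M)"
    by (simp add: fun_eq_iff fourier_pairing_def fourier_cmult sum_distrib_left mult_ac)
  moreover have "(\<lambda>M. c * fourier_pairing h f M)
      \<longlonglongrightarrow> c * (2 * complex_of_real pi * (LINT x|period. f x * h x))"
    using f by (intro tendsto_mult_left) (simp add: parseval_def)
  moreover have "c * (2 * complex_of_real pi * (LINT x|period. f x * h x))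
      = 2 * complex_of_real pi * (LINT x|period. c * f x * h x)"
    by (simp add: mult.assoc mult.left_commute)
  ultimately show ?thesis
    using f by (simp only: parseval_def square_integrable_cmult)
qed

text \<open>Replacing \<open>f\<close> by \<open>g\<close> changes the pairing and the integral term
  each by at most 2 pi \<open>norm2\<close> (f - g) \<open>norm2\<close> h, uniformly in
  \<open>M\<close>; the remaining error is the convergence for \<open>g\<close>.\<close>

lemma parseval_closure:
  assumes h: "square_integrable h" and f: "square_integrable f"
    and approx: "\<And>e. e > 0 \<Longrightarrow> \<exists>g. parseval h g \<and> norm2 (\<lambda>x. f x - g x) < e"
  shows "parseval h f"
proof -
  have "fourier_pairing h f \<longlonglongrightarrow> 2 * complex_of_real pi * (LINT x|period. f x * h x)"
  proof (rule LIMSEQ_I)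
    fix r :: real assume "r > 0"
    \<comment> \<open>Twice 2 pi \<open>norm2\<close> h, one for each replaced term; the summand 1
      keeps \<open>c\<close> positive when h has norm 0.\<close>
    define c where "c = 4 * pi * norm2 h + 1"
    have c: "c > 0" using norm2_nonneg[of h] pi_gt_zero by (auto simp: c_def intro!: add_nonneg_pos)
    obtain g where g: "parseval h g" and fg: "norm2 (\<lambda>x. f x - g x) < r / (2 * c)"
      using approx[of "r / (2 * c)"] \<open>r > 0\<close> c by auto
    have sg: "square_integrable g" using g by (simp add: parseval_def)
    let ?u = "\<lambda>x. f x - g x"
    have su: "square_integrable ?u" by (intro square_integrable_diff f sg)
    obtain M0 where M0: "\<And>M. M \<ge> M0 \<Longrightarrow> norm (fourier_pairing h g M - 2 * complex_of_real pi * (LINT x|period. g x * h x)) < r / 2"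
      using g \<open>r > 0\<close> unfolding parseval_def by (metis LIMSEQ_D half_gt_zero)
    show "\<exists>M0. \<forall>M\<ge>M0. norm (fourier_pairing h f M - 2 * complex_of_real pi * (LINT x|period. f x * h x)) < r"
    proof (intro exI allI impI)
      fix M assume M: "M0 \<le> M"
      have 1: "fourier_pairing h f M = fourier_pairing h g M + fourier_pairing h ?u M"
        by (simp add: fourier_pairing_def fourier_diff f sg sum.distrib[symmetric] algebra_simps)
      have 2: "(LINT x|period. f x * h x) = (LINT x|period. g x * h x) + (LINT x|period. ?u x * h x)"
        using f sg h by (simp add: left_diff_distrib integrable_mult_square_integrable)
      have "fourier_pairing h f M - 2 * complex_of_real pi * (LINT x|period. f x * h x)
          = (fourier_pairing h g M - 2 * complex_of_real pi * (LINT x|period. g x * h x))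
            + (fourier_pairing h ?u M - 2 * complex_of_real pi * (LINT x|period. ?u x * h x))"
        unfolding 1 2 by (simp add: algebra_simps)
      then have "norm (fourier_pairing h f M - 2 * complex_of_real pi * (LINT x|period. f x * h x))
          \<le> norm (fourier_pairing h g M - 2 * complex_of_real pi * (LINT x|period. g x * h x))
          + (norm (fourier_pairing h ?u M) + norm (2 * complex_of_real pi * (LINT x|period. ?u x * h x)))"
        by (simp only:) (intro norm_triangle_le add_left_mono norm_triangle_ineq4)
      moreover have "norm (2 * complex_of_real pi * (LINT x|period. ?u x * h x)) \<le> 2 * pi * (norm2 ?u * norm2 h)"
        using norm_integral_mult_le[OF su h] by (simp add: norm_mult)
      ultimately have "norm (fourier_pairing h f M - 2 * complex_of_real pi * (LINT x|period. f x * h x))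
          < r / 2 + (2 * pi * (norm2 ?u * norm2 h) + 2 * pi * (norm2 ?u * norm2 h))"
        using M0[OF M] norm_fourier_pairing_le[OF su h, of M] by linarith
      also have "\<dots> \<le> r / 2 + norm2 ?u * c"
        using norm2_nonneg[of ?u] by (simp add: c_def algebra_simps)
      also have "\<dots> \<le> r / 2 + r / (2 * c) * c"
        using fg c by (intro add_left_mono mult_right_mono) auto
      also have "\<dots> = r" using c by simp
      finally show "norm (fourier_pairing h f M - 2 * complex_of_real pi * (LINT x|period. f x * h x)) < r" .
    qed
  qed
  with f show ?thesis by (simp add: parseval_def)
qed

text \<open>Dominated convergence turns pointwise convergence into L^2 convergence, so each later
  extension only needs a pointwise limit and an integrable majorant.\<close>

lemma parseval_limit:
  assumes h: "square_integrable h" and f: "square_integrable f"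
    and g: "\<And>k. parseval h (g k)" and w: "integrable period w"
    and lim: "\<And>x. x \<in> {-pi..pi} \<Longrightarrow> (\<lambda>k. g k x) \<longlonglongrightarrow> f x"
    and dom: "\<And>k x. x \<in> {-pi..pi} \<Longrightarrow> (norm (f x - g k x))\<^sup>2 \<le> w x"
  shows "parseval h f"
proof (rule parseval_closure[OF h f])
  fix e :: real assume "e > 0"
  have [measurable]: "f \<in> borel_measurable period" "g k \<in> borel_measurable period" for k
    using f g by (auto simp: parseval_def square_integrable_def)
  have "(\<lambda>k. LINT x|period. (norm (f x - g k x))\<^sup>2) \<longlonglongrightarrow> (LINT x|period. 0)"
  proof (rule integral_dominated_convergence[OF _ _ w])
    show "AE x in period. (\<lambda>k. (norm (f x - g k x))\<^sup>2) \<longlonglongrightarrow> 0"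
      using lim by (auto intro!: AE_I2 tendsto_eq_intros)
  qed (use dom in auto)
  then have "(\<lambda>k. norm2 (\<lambda>x. f x - g k x)) \<longlonglongrightarrow> sqrt (LINT x|period. 0)"
    unfolding norm2_def by (intro tendsto_real_sqrt)
  then have "(\<lambda>k. norm2 (\<lambda>x. f x - g k x)) \<longlonglongrightarrow> 0" by simp
  then have "\<forall>\<^sub>F k in sequentially. norm2 (\<lambda>x. f x - g k x) < e"
    using \<open>e > 0\<close> by (rule order_tendstoD)
  then obtain k where "norm2 (\<lambda>x. f x - g k x) < e"
    by (auto simp: eventually_sequentially)
  then show "\<exists>g. parseval h g \<and> norm2 (\<lambda>x. f x - g x) < e" using g by blast
qed

section \<open>Trigonometric polynomials and continuous functions on the circle\<close>

inductive trig_poly :: "(real \<Rightarrow> complex) \<Rightarrow> bool" where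
  monom: "trig_poly (\<lambda>x. c * cis (real_of_int k * x))"
| add: "trig_poly f \<Longrightarrow> trig_poly g \<Longrightarrow> trig_poly (\<lambda>x. f x + g x)"

lemma trig_poly_mult:
  assumes "trig_poly f" "trig_poly g"
  shows "trig_poly (\<lambda>x. f x * g x)"
  using assms(1)
proof induction
  case (monom c k)
  from assms(2) show ?case
  proof induction
    case (monom d l)
    have "(\<lambda>x. c * cis (real_of_int k * x) * (d * cis (real_of_int l * x)))
        = (\<lambda>x. (c * d) * cis (real_of_int (k + l) * x))"
      by (simp add: fun_eq_iff distrib_right flip: cis_mult)
    then show ?case by (metis trig_poly.monom)
  qed (simp add: distrib_left trig_poly.add)
qed (simp add: distrib_right trig_poly.add)

lemma trig_poly_const: "trig_poly (\<lambda>x. c)"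
  using trig_poly.monom[of c 0] by simp

text \<open>Stone--Weierstrass supplies real polynomials on the plane; these are generated by real
  linear forms and constants under sums and products, and on the circle a linear form is a
  combination of cos and sin.\<close>

lemma trig_poly_real_polynomial_cis:
  assumes "real_polynomial_function g"
  shows "trig_poly (\<lambda>x. complex_of_real (g (cis x)))"
  using assms
proof induction
  case (linear f)
  interpret bounded_linear f by fact
  define c d where "c = complex_of_real (f 1)" and "d = complex_of_real (f \<i>)"
  \<comment> \<open>Euler's formulas applied to f (cis x) = f(1) cos x + f(i) sin x.\<close>
  have "complex_of_real (f (cis x)) = (c - \<i> * d) / 2 * cis (real_of_int 1 * x) + (c + \<i> * d) / 2 * cis (real_of_int (-1) * x)" for x
  proof -
    have "cis x = cos x *\<^sub>R 1 + sin x *\<^sub>R \<i>" by (simp add: complex_eq_iff)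
    then have "f (cis x) = cos x * f 1 + sin x * f \<i>"
      using add scale by (metis real_scaleR_def)
    then show ?thesis by (simp add: complex_eq_iff c_def d_def field_simps)
  qed
  then show ?case by (simp only:) (intro trig_poly.intros)
next
  case (const c)
  show ?case by (rule trig_poly_const)
qed (simp_all add: trig_poly.add trig_poly_mult)

lemma parseval_trig_poly:
  assumes h: "square_integrable h" and "trig_poly f"
  shows "parseval h f"
  using assms(2)
proof induction
  case (monom c k)
  have "parseval h (\<lambda>x. cis (real_of_int k * x))"
  proof -
    \<comment> \<open>By orthogonality only the index -k contributes, so the pairing is constant
      once the window contains it.\<close>
    have "fourier_pairing h (\<lambda>x. cis (real_of_int k * x)) M = 2 * complex_of_real pi * fourier h k"
      if "M \<ge> nat \<bar>k\<bar>" for M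
    proof -
      have "fourier_pairing h (\<lambda>x. cis (real_of_int k * x)) M
          = (\<Sum>j\<in>{-int M..int M}. if j = -k then 2 * complex_of_real pi * fourier h k else 0)"
        unfolding fourier_pairing_def fourier_cis by (intro sum.cong) auto
      also have "\<dots> = 2 * complex_of_real pi * fourier h k"
        using that by (subst sum.delta) auto
      finally show ?thesis .
    qed
    then have "fourier_pairing h (\<lambda>x. cis (real_of_int k * x)) \<longlonglongrightarrow> 2 * complex_of_real pi * fourier h k"
      by (intro tendsto_eventually) (auto simp: eventually_sequentially)
    then show ?thesis
      by (simp add: parseval_def square_integrable_cis fourier_def)
  qed
  then show ?case by (rule parseval_cmult)
qed (rule parseval_add[OF h])

text \<open>Composing with \<open>cis\<close> builds in the identification of -pi and pi: a
  continuous function on the interval with different endpoint values is no uniform limit of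
  trigonometric polynomials.\<close>

lemma parseval_continuous_cis:
  fixes g :: "complex \<Rightarrow> real"
  assumes h: "square_integrable h" and g: "continuous_on UNIV g"
  shows "parseval h (\<lambda>x. complex_of_real (g (cis x)))"
proof -
  have cont: "continuous_on (sphere 0 1) g" using g continuous_on_subset by blast
  define P where "P k G \<longleftrightarrow> real_polynomial_function G \<and>
      (\<forall>z\<in>sphere (0::complex) 1. \<bar>g z - G z\<bar> < inverse (real (Suc k)))" for k G
  have "\<exists>G. P k G" for k
    using Stone_Weierstrass_real_polynomial_function[OF compact_sphere cont, of "inverse (real (Suc k))"]
    unfolding P_def by (metis inverse_positive_iff_positive of_nat_0_less_iff zero_less_Suc)
  then obtain G where G: "P k (G k)" for k by metis
  have bd: "\<bar>g (cis x) - G k (cis x)\<bar> < inverse (real (Suc k))" for k x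
    using G[of k] by (auto simp: P_def)
  obtain B where B: "\<forall>y\<in>g ` sphere 0 1. norm y \<le> B"
    using compact_imp_bounded[OF compact_continuous_image[OF cont compact_sphere]]
    unfolding bounded_iff by blast
  show ?thesis
  proof (rule parseval_limit[OF h, where g = "\<lambda>k x. complex_of_real (G k (cis x))" and w = "\<lambda>_. 1"])
    show "square_integrable (\<lambda>x. complex_of_real (g (cis x)))"
    proof (rule square_integrable_bounded[where B = B])
      show "(\<lambda>x. complex_of_real (g (cis x))) \<in> borel_measurable period"
        by (intro borel_measurable_period borel_measurable_continuous_onI continuous_intros
            continuous_on_compose2[OF g]) auto
    qed (use B in auto)
    show "parseval h (\<lambda>x. complex_of_real (G k (cis x)))" for k
      using G by (intro parseval_trig_poly h trig_poly_real_polynomial_cis) (simp add: P_def)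
    show "integrable period (\<lambda>_. 1 :: real)"
      by (rule integrable_period_bounded[where B = 1]) auto
    show "(\<lambda>k. complex_of_real (G k (cis x))) \<longlonglongrightarrow> complex_of_real (g (cis x))" for x
    proof (rule tendsto_of_real, rule Lim_null_comparison[THEN Lim_null[THEN iffD2]])
      show "\<forall>\<^sub>F k in sequentially. norm (G k (cis x) - g (cis x)) \<le> inverse (real (Suc k))"
        using bd[of x] by (auto intro!: always_eventually less_imp_le simp: abs_minus_commute)
    qed (rule LIMSEQ_inverse_real_of_nat)
    show "(norm (complex_of_real (g (cis x)) - complex_of_real (G k (cis x))))\<^sup>2 \<le> 1" for k x
    proof -
      have "inverse (real (Suc k)) \<le> 1" by (simp add: inverse_le_1_iff)
      then have "\<bar>g (cis x) - G k (cis x)\<bar> \<le> 1" using bd[of x k] by linarith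
      then show ?thesis by (simp add: abs_square_le_1 flip: of_real_diff)
    qed
  qed
qed

section \<open>From open sets to Borel functions on the circle\<close>

lemma measurable_cis_period: "cis \<in> measurable period borel"
  by (intro borel_measurable_period borel_measurable_continuous_onI continuous_intros)

lemma square_integrable_indicator_cis:
  assumes "A \<in> sets borel"
  shows "square_integrable (\<lambda>x. complex_of_real (indicator A (cis x)))"
proof (rule square_integrable_bounded[where B = 1])
  note measurable_cis_period [measurable] assms [measurable]
  show "(\<lambda>x. complex_of_real (indicator A (cis x))) \<in> borel_measurable period"
    by measurable
qed (simp add: indicator_def)

text \<open>The indicator of an open set is the pointwise limit of continuous functions built from
  the distance to its complement, cut off at 1.\<close>

lemma parseval_indicator_cis_open:
  assumes h: "square_integrable h" and U: "open U"
  shows "parseval h (\<lambda>x. complex_of_real (indicator U (cis x)))"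
proof (cases "U = UNIV")
  \<comment> \<open>Treated apart because \<open>infdist\<close> to the empty set is 0, which would
    make every \<open>g k\<close> vanish.\<close>
  case True
  then show ?thesis using parseval_trig_poly[OF h trig_poly_const[of 1]] by simp
next
  case False
  define g where "g k z = min 1 (real k * infdist z (- U))" for k and z :: complex
  have g01: "0 \<le> g k z" "g k z \<le> 1" for k z
    by (auto simp: g_def infdist_nonneg)
  have g_out: "g k z = 0" if "z \<notin> U" for k z
    using that by (simp add: g_def)
  have lim: "(\<lambda>k. g k z) \<longlonglongrightarrow> indicator U z" for z
  proof (cases "z \<in> U")
    case True
    have pos: "infdist z (- U) > 0"
      using True False U infdist_nonneg[of z "- U"] in_closed_iff_infdist_zero[of "- U" z]
      by (force simp: order_less_le)
    obtain K where K: "1 < real K * infdist z (- U)"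
      using reals_Archimedean3[OF pos] by blast
    have "g k z = 1" if "k \<ge> K" for k
    proof -
      have "real K * infdist z (- U) \<le> real k * infdist z (- U)"
        using that pos by (intro mult_right_mono) auto
      then show ?thesis using K by (simp add: g_def)
    qed
    then have "(\<lambda>k. g k z) \<longlonglongrightarrow> 1"
      by (intro tendsto_eventually) (auto simp: eventually_sequentially)
    then show ?thesis using True by simp
  qed (simp add: g_out)
  show ?thesis
  proof (rule parseval_limit[OF h, where g = "\<lambda>k x. complex_of_real (g k (cis x))" and w = "\<lambda>_. 1"])
    show "square_integrable (\<lambda>x. complex_of_real (indicator U (cis x)))"
      using U by (intro square_integrable_indicator_cis) auto
    show "parseval h (\<lambda>x. complex_of_real (g k (cis x)))" for k
      unfolding g_def by (intro parseval_continuous_cis h continuous_intros)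
    show "integrable period (\<lambda>_. 1 :: real)"
      by (rule integrable_period_bounded[where B = 1]) auto
    show "(\<lambda>k. complex_of_real (g k (cis x))) \<longlonglongrightarrow> complex_of_real (indicator U (cis x))" for x
      by (intro tendsto_of_real lim)
    show "(norm (complex_of_real (indicator U (cis x)) - complex_of_real (g k (cis x))))\<^sup>2 \<le> 1" for k x
      using g01[of k "cis x"]
      by (auto simp: indicator_def power_le_one g_out simp flip: of_real_diff intro!: power_le_one)
  qed
qed

text \<open>Dynkin's argument: open sets are stable under intersection, and since Parseval is linear
  in the function but not multiplicative, only complements and disjoint unions have to be
  handled.\<close>

lemma parseval_indicator_cis:
  assumes h: "square_integrable h" and A: "A \<in> sets borel"
  shows "parseval h (\<lambda>x. complex_of_real (indicator A (cis x)))"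
proof -
  have A': "A \<in> sigma_sets UNIV {U. open U}"
    using A by (simp add: borel_def)
  have stable: "Int_stable {U :: complex set. open U}"
    by (auto simp: Int_stable_def)
  have one: "parseval h (\<lambda>x. 1)"
    using parseval_trig_poly[OF h trig_poly_const[of 1]] .
  have Pow: "{U :: complex set. open U} \<subseteq> Pow UNIV" by auto
  from stable Pow A' show ?thesis
  proof (induction rule: sigma_sets_induct_disjoint)
    case (basic A)
    then show ?case by (simp add: parseval_indicator_cis_open h)
  next
    case empty
    show ?case using parseval_trig_poly[OF h trig_poly_const[of 0]] by simp
  next
    case (compl A)
    have "parseval h (\<lambda>x. 1 + (-1) * complex_of_real (indicator A (cis x)))"
      by (intro parseval_add parseval_cmult h one compl.IH)
    moreover have "(\<lambda>x. 1 + (-1) * complex_of_real (indicator A (cis x))) = (\<lambda>x. complex_of_real (indicator (UNIV - A) (cis x)))"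
      by (auto simp: fun_eq_iff indicator_def)
    ultimately show ?case by simp
  next
    case (union A)
    have meas: "A i \<in> sets borel" for i
      using union.hyps(2) by (auto simp: borel_def)
    let ?g = "\<lambda>k x. complex_of_real (indicator (\<Union>i<k. A i) (cis x))"
    show ?case
    proof (rule parseval_limit[OF h, where g = ?g and w = "\<lambda>_. 1"])
      show "square_integrable (\<lambda>x. complex_of_real (indicator (\<Union> (range A)) (cis x)))"
        using meas by (intro square_integrable_indicator_cis) auto
      show "parseval h (?g k)" for k
      proof (induction k)
        case 0
        show ?case using parseval_trig_poly[OF h trig_poly_const[of 0]] by simp
      next
        case (Suc k)
        have "indicator (\<Union>i<Suc k. A i) z = indicator (\<Union>i<k. A i) z + (indicator (A k) z :: real)" for z
        proof -
          have "z \<notin> A i" if "z \<in> A k" "i < k" for i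
            using union.hyps(1) that by (metis disjoint_family_onD disjoint_iff less_irrefl UNIV_I)
          then show ?thesis by (auto simp: indicator_def lessThan_Suc)
        qed
        then show ?case
          using parseval_add[OF h Suc union.IH[of k]] by simp
      qed
      show "integrable period (\<lambda>_. 1 :: real)"
        by (rule integrable_period_bounded[where B = 1]) auto
      show "(\<lambda>k. ?g k x) \<longlonglongrightarrow> complex_of_real (indicator (\<Union> (range A)) (cis x))" for x
        by (intro tendsto_of_real LIMSEQ_indicator_UN)
      show "(norm (complex_of_real (indicator (\<Union> (range A)) (cis x)) - ?g k x))\<^sup>2 \<le> 1" for k x
        by (auto simp: indicator_def)
    qed
  qed
qed

lemma parseval_nonneg_cis:
  fixes u :: "complex \<Rightarrow> real"
  assumes h: "square_integrable h" and u: "u \<in> borel_measurable borel" "\<And>z. 0 \<le> u z"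
    and sq: "square_integrable (\<lambda>x. complex_of_real (u (cis x)))"
  shows "parseval h (\<lambda>x. complex_of_real (u (cis x)))"
proof -
  have comp: "(\<lambda>x. complex_of_real (v (cis x))) \<in> borel_measurable period"
    if "v \<in> borel_measurable borel" for v :: "complex \<Rightarrow> real"
    using measurable_compose[OF measurable_cis_period that] by measurable
  \<comment> \<open>Square integrability is carried as a premise of the inductive claim: each
    approximant inherits it from the larger function by domination, as everything is
    nonnegative.\<close>
  have "square_integrable (\<lambda>x. complex_of_real (u (cis x))) \<longrightarrow> parseval h (\<lambda>x. complex_of_real (u (cis x)))"
    using u
  proof (induction rule: borel_measurable_induct_real)
    case (set A)
    then show ?case by (simp add: parseval_indicator_cis h)
  next
    case (mult u c)
    show ?case
    proof (cases "c = 0")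
      case True
      then show ?thesis using parseval_trig_poly[OF h trig_poly_const[of 0]] by simp
    next
      case False
      show ?thesis
      proof
        assume "square_integrable (\<lambda>x. complex_of_real (c * u (cis x)))"
        then have "square_integrable (\<lambda>x. complex_of_real (inverse c) * complex_of_real (c * u (cis x)))"
          by (rule square_integrable_cmult)
        then have "square_integrable (\<lambda>x. complex_of_real (u (cis x)))"
          using False by (simp add: field_simps)
        then show "parseval h (\<lambda>x. complex_of_real (c * u (cis x)))"
          using mult.IH parseval_cmult[of h _ "complex_of_real c"] by simp
      qed
    qed
  next
    case (add u v)
    show ?case
    proof
      assume sq: "square_integrable (\<lambda>x. complex_of_real (v (cis x) + u (cis x)))"
      have "square_integrable (\<lambda>x. complex_of_real (u (cis x)))"
        by (rule square_integrable_dominated[OF sq comp]) (use add in \<open>auto simp flip: of_real_add\<close>)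
      moreover have "square_integrable (\<lambda>x. complex_of_real (v (cis x)))"
        by (rule square_integrable_dominated[OF sq comp]) (use add in \<open>auto simp flip: of_real_add\<close>)
      ultimately show "parseval h (\<lambda>x. complex_of_real (v (cis x) + u (cis x)))"
        using parseval_add[OF h] add.IH by simp
    qed
  next
    case (seq U)
    have le: "U i z \<le> u z" for i z
    proof (rule incseq_le)
      show "incseq (\<lambda>i. U i z)" using seq.hyps(3) by (auto simp: incseq_def le_fun_def)
      show "(\<lambda>i. U i z) \<longlonglongrightarrow> u z" using seq.hyps(4) by simp
    qed
    show ?case
    proof
      assume sq: "square_integrable (\<lambda>x. complex_of_real (u (cis x)))"
      show "parseval h (\<lambda>x. complex_of_real (u (cis x)))"
      proof (rule parseval_limit[OF h sq, where g = "\<lambda>k x. complex_of_real (U k (cis x))"])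
        show "parseval h (\<lambda>x. complex_of_real (U k (cis x)))" for k
        proof -
          have "square_integrable (\<lambda>x. complex_of_real (U k (cis x)))"
            by (rule square_integrable_dominated[OF sq comp]) (use seq.hyps(1,2) le u in auto)
          then show ?thesis using seq.IH by blast
        qed
        show "integrable period (\<lambda>x. (norm (complex_of_real (u (cis x))))\<^sup>2)"
          using sq by (simp add: square_integrable_def)
        show "(\<lambda>k. complex_of_real (U k (cis x))) \<longlonglongrightarrow> complex_of_real (u (cis x))" for x
          using seq.hyps(4) by (intro tendsto_of_real) simp
        show "(norm (complex_of_real (u (cis x)) - complex_of_real (U k (cis x))))\<^sup>2 \<le> (norm (complex_of_real (u (cis x))))\<^sup>2" for k x
          using le[of k "cis x"] seq.hyps(2)[of k "cis x"] u(2)[of "cis x"]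
          by (auto simp flip: of_real_diff intro!: power_mono)
      qed
    qed
  qed
  with sq show ?thesis by blast
qed

text \<open>Transfers the result from functions on the circle to functions on the interval; the two
  differ only at the endpoints, a null set.\<close>

lemma parseval_nonneg:
  fixes p :: "real \<Rightarrow> real"
  assumes h: "square_integrable h" and p: "p \<in> borel_measurable borel" "\<And>x. x \<in> {-pi..pi} \<Longrightarrow> 0 \<le> p x"
    and sq: "square_integrable (\<lambda>x. complex_of_real (p x))"
  shows "parseval h (\<lambda>x. complex_of_real (p x))"
proof -
  \<comment> \<open>A Borel left inverse of \<open>cis\<close> on the open interval:
    \<open>Arg\<close> is continuous off the nonpositive real axis, and the value there is set to 0,
    a point where \<open>p\<close> is still nonnegative.\<close>
  define A where "A z = indicator (- \<real>\<^sub>\<le>\<^sub>0) z *\<^sub>R Arg z" for z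
  define u where "u z = p (A z)" for z
  have A: "A \<in> borel_measurable borel"
    unfolding A_def by (intro borel_measurable_continuous_on_indicator continuous_on_Arg) auto
  have u: "u \<in> borel_measurable borel"
    unfolding u_def using p(1) A by measurable
  have u0: "0 \<le> u z" for z
    using p(2) Arg_bounded[of z] by (auto simp: u_def A_def indicator_def)
  have u_cis: "u (cis x) = p x" if "x \<in> {-pi..pi}" "x \<noteq> -pi" "x \<noteq> pi" for x
  proof -
    have Arg: "Arg (cis x) = x"
      using that by (intro Arg_cis) auto
    have "cis x \<notin> \<real>\<^sub>\<le>\<^sub>0"
    proof
      assume "cis x \<in> \<real>\<^sub>\<le>\<^sub>0"
      then have "sin x = 0" "cos x \<le> 0" by (auto simp: complex_nonpos_Reals_iff)
      moreover have "cos x \<noteq> 0"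
        using \<open>sin x = 0\<close> sin_zero_abs_cos_one by fastforce
      ultimately have "Arg (cis x) = pi" by (simp add: Arg_eq_pi)
      then show False using Arg that by simp
    qed
    then show ?thesis by (simp add: u_def A_def Arg)
  qed
  have AE: "AE x in period. u (cis x) = p x"
  proof -
    have "AE x in lborel. x \<noteq> -pi \<and> x \<noteq> pi"
      using AE_lborel_singleton[of "-pi"] AE_lborel_singleton[of pi] by eventually_elim auto
    then have "AE x in period. x \<noteq> -pi \<and> x \<noteq> pi"
      unfolding period_def by (subst AE_restrict_space_iff) auto
    then show ?thesis
      by (rule AE_mp) (auto intro!: AE_I2 simp: u_cis)
  qed
  have m: "(\<lambda>x. complex_of_real (u (cis x))) \<in> borel_measurable period"
    using measurable_compose[OF measurable_cis_period u] by measurable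
  have "integrable period (\<lambda>x. (norm (complex_of_real (u (cis x))))\<^sup>2)
      \<longleftrightarrow> integrable period (\<lambda>x. (norm (complex_of_real (p x)))\<^sup>2)"
    using AE measurable_compose[OF measurable_cis_period u] borel_measurable_period[OF p(1)]
    by (intro integrable_cong_AE) auto
  then have squ: "square_integrable (\<lambda>x. complex_of_real (u (cis x)))"
    using sq m by (simp add: square_integrable_def)
  \<comment> \<open>Functions equal almost everywhere are at \<open>norm2\<close> distance 0, so one
    approximant serves every e.\<close>
  show ?thesis
  proof (rule parseval_closure[OF h sq], intro exI conjI)
    show "parseval h (\<lambda>x. complex_of_real (u (cis x)))"
      by (rule parseval_nonneg_cis[OF h u u0 squ])
    fix e :: real assume "e > 0"
    have "(LINT x|period. (norm (complex_of_real (p x) - complex_of_real (u (cis x))))\<^sup>2) = (LINT x|period. 0)"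
      using AE m sq by (intro integral_cong_AE) (auto simp: square_integrable_def)
    then show "norm2 (\<lambda>x. complex_of_real (p x) - complex_of_real (u (cis x))) < e"
      using \<open>e > 0\<close> by (simp add: norm2_def)
  qed
qed

section \<open>Sums over integer vectors\<close>

text \<open>Parseval yields only limits over symmetric windows. For nonnegative terms these bound
  all finite sums, so the family is summable unconditionally, and the windows are cofinal among
  finite sets.\<close>

lemma has_sum_int_symmetric:
  fixes f :: "int \<Rightarrow> real"
  assumes nonneg: "\<And>j. 0 \<le> f j"
    and lim: "(\<lambda>M. \<Sum>j\<in>{-int M..int M}. f j) \<longlonglongrightarrow> S"
  shows "(f has_sum S) UNIV"
proof -
  have inc: "incseq (\<lambda>M. \<Sum>j\<in>{-int M..int M}. f j)"
    by (intro incseq_SucI sum_mono2) (auto simp: nonneg)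
  have bd: "sum f X \<le> S" if "finite X" for X
  proof -
    \<comment> \<open>The inserted 0 makes the maximum meaningful for empty
      \<open>X\<close>.\<close>
    define M where "M = Max (insert 0 ((\<lambda>x. nat \<bar>x\<bar>) ` X))"
    have M: "nat \<bar>x\<bar> \<le> M" if "x \<in> X" for x
      using \<open>finite X\<close> that by (auto simp: M_def)
    have "x \<in> {-int M..int M}" if "x \<in> X" for x
      using M[OF that] by auto
    then have "sum f X \<le> (\<Sum>j\<in>{-int M..int M}. f j)"
      by (intro sum_mono2) (auto simp: nonneg)
    also have "\<dots> \<le> S"
      using incseq_le[OF inc lim] .
    finally show ?thesis .
  qed
  have "f summable_on UNIV"
    by (rule nonneg_bdd_above_summable_on) (auto simp: nonneg bd intro!: bdd_aboveI2[of _ _ S])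
  then have hs: "(f has_sum infsum f UNIV) UNIV" by (rule has_sum_infsum)
  have "filterlim (\<lambda>M. {-int M..int M}) (finite_subsets_at_top UNIV) sequentially"
    unfolding filterlim_finite_subsets_at_top
  proof (intro allI impI)
    fix X :: "int set" assume X: "finite X \<and> X \<subseteq> UNIV"
    define M where "M = Max (insert 0 ((\<lambda>x. nat \<bar>x\<bar>) ` X))"
    have M: "nat \<bar>x\<bar> \<le> M" if "x \<in> X" for x
      using X that by (auto simp: M_def)
    show "\<forall>\<^sub>F N in sequentially. finite {-int N..int N} \<and> X \<subseteq> {-int N..int N} \<and> {-int N..int N} \<subseteq> UNIV"
      unfolding eventually_sequentially using M by (intro exI[of _ M]) force
  qed
  then have "(\<lambda>M. \<Sum>j\<in>{-int M..int M}. f j) \<longlonglongrightarrow> infsum f UNIV"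
    using hs unfolding has_sum_def by (rule filterlim_compose[rotated])
  with lim hs show ?thesis using LIMSEQ_unique by blast
qed

text \<open>In the application \<open>\<alpha> k\<close> holds the coefficients of p^k and
  \<open>c\<close> is 2 pi. The total \<open>s\<close> stays general because splitting off one
  coordinate j leaves the total s - j. Dividing by \<open>c\<close> compensates that
  \<open>\<alpha> 0\<close> is \<open>c\<close> times the unit mass at 0, so the empty product gives
  1 at s = 0.\<close>

lemma has_sum_prod_convolution:
  fixes \<alpha> :: "nat \<Rightarrow> int \<Rightarrow> real"
  assumes nonneg: "\<And>k m. 0 \<le> \<alpha> k m"
    and zero: "\<And>m. \<alpha> 0 m = (if m = 0 then c else 0)" and c: "c > 0"
    and conv: "\<And>k s. ((\<lambda>j. \<alpha> 1 j * \<alpha> k (s - j)) has_sum c * \<alpha> (Suc k) s) UNIV"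
    and F: "finite F"
  shows "((\<lambda>m. \<Prod>b\<in>F. \<alpha> 1 (m b)) has_sum c ^ card F / c * \<alpha> (card F) s)
           {m \<in> Pi\<^sub>E F (\<lambda>_. UNIV). (\<Sum>b\<in>F. m b) = s}"
  using F
proof (induction F arbitrary: s rule: finite_induct)
  case empty
  show ?case
  proof (cases "s = 0")
    case True
    then have "{m \<in> Pi\<^sub>E {} (\<lambda>_. UNIV). (\<Sum>b\<in>{}. m b) = s} = {\<lambda>_::'a. undefined}" by auto
    then show ?thesis using True c by (auto simp: zero intro!: has_sum_finiteI)
  qed (simp add: zero)
next
  case (insert b F)
  define D where "D s = {m \<in> Pi\<^sub>E F (\<lambda>_. UNIV :: int set). (\<Sum>b\<in>F. m b) = s}" for s
  define f where "f = (\<lambda>(j, m). \<alpha> 1 j * (\<Prod>b\<in>F. \<alpha> 1 (m b)))"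
  define g where "g j = \<alpha> 1 j * (c ^ card F / c * \<alpha> (card F) (s - j))" for j
  have f: "((\<lambda>m. f (j, m)) has_sum g j) (D (s - j))" for j
    unfolding f_def g_def D_def using has_sum_cmult_right[OF insert.IH] by simp
  have "((\<lambda>j. c ^ card F / c * (\<alpha> 1 j * \<alpha> (card F) (s - j))) has_sum c ^ card F / c * (c * \<alpha> (Suc (card F)) s)) UNIV"
    by (intro has_sum_cmult_right conv)
  moreover have "c ^ card F / c * (c * \<alpha> (Suc (card F)) s) = c ^ Suc (card F) / c * \<alpha> (Suc (card F)) s"
    using c by simp
  ultimately have g: "(g has_sum c ^ Suc (card F) / c * \<alpha> (Suc (card F)) s) UNIV"
    unfolding g_def by (simp only: mult_ac)
  \<comment> \<open>Tonelli for sums: with nonnegative terms, summability of the inner sums over j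
    gives joint summability.\<close>
  have "f summable_on Sigma UNIV (\<lambda>j. D (s - j))"
  proof (rule summable_on_SigmaI)
    show "g summable_on UNIV" using g by (rule has_sum_imp_summable)
    show "\<And>x y. 0 \<le> f (x, y)" by (simp add: f_def nonneg prod_nonneg)
  qed (rule f)
  with f g have fs: "(f has_sum c ^ Suc (card F) / c * \<alpha> (Suc (card F)) s) (Sigma UNIV (\<lambda>j. D (s - j)))"
    by (intro has_sum_SigmaI) auto
  have upd: "(\<Sum>a\<in>F. if a = b then j else m a) = (\<Sum>a\<in>F. m a)" for m :: "'a \<Rightarrow> int" and j
    using insert.hyps(2) by (intro sum.cong) auto
  \<comment> \<open>Splitting off the coordinate at \<open>b\<close> must reset it to
    \<open>undefined\<close>, the value of extensional functions outside their domain.\<close>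
  have bij: "bij_betw (\<lambda>(j, m). m(b := j)) (Sigma UNIV (\<lambda>j. D (s - j)))
      {m \<in> Pi\<^sub>E (insert b F) (\<lambda>_. UNIV). (\<Sum>b\<in>insert b F. m b) = s}"
  proof (rule bij_betw_byWitness[where f' = "\<lambda>m. (m b, m(b := undefined))"])
    show "\<forall>a\<in>Sigma UNIV (\<lambda>j. D (s - j)). (\<lambda>m. (m b, m(b := undefined))) ((\<lambda>(j, m). m(b := j)) a) = a"
      using insert.hyps(2) by (auto simp: D_def PiE_def extensional_def fun_eq_iff)
    show "\<forall>m\<in>{m \<in> Pi\<^sub>E (insert b F) (\<lambda>_. UNIV). (\<Sum>b\<in>insert b F. m b) = s}.
        (\<lambda>(j, m). m(b := j)) (m b, m(b := undefined)) = m"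
      by auto
    show "(\<lambda>(j, m). m(b := j)) ` (Sigma UNIV (\<lambda>j. D (s - j)))
        \<subseteq> {m \<in> Pi\<^sub>E (insert b F) (\<lambda>_. UNIV). (\<Sum>b\<in>insert b F. m b) = s}"
      using insert.hyps by (auto simp: D_def PiE_def extensional_def upd)
    show "(\<lambda>m. (m b, m(b := undefined))) ` {m \<in> Pi\<^sub>E (insert b F) (\<lambda>_. UNIV). (\<Sum>b\<in>insert b F. m b) = s}
        \<subseteq> Sigma UNIV (\<lambda>j. D (s - j))"
    proof (rule image_subsetI)
      fix m assume m: "m \<in> {m \<in> Pi\<^sub>E (insert b F) (\<lambda>_. UNIV :: int set). (\<Sum>b\<in>insert b F. m b) = s}"
      then have "m b + sum m F = s" using insert.hyps by simp
      then show "(m b, m(b := undefined)) \<in> Sigma UNIV (\<lambda>j. D (s - j))"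
        using m by (auto simp: D_def PiE_def extensional_def upd)
    qed
  qed
  have eq: "f a = (\<Prod>i\<in>insert b F. \<alpha> 1 (((\<lambda>(j, m). m(b := j)) a) i))" for a
  proof (cases a)
    case (Pair j m)
    have "(\<Prod>a\<in>F. \<alpha> 1 ((m(b := j)) a)) = (\<Prod>a\<in>F. \<alpha> 1 (m a))"
      using insert.hyps(2) by (intro prod.cong) auto
    then show ?thesis using insert.hyps by (simp add: f_def Pair)
  qed
  have fs': "((\<lambda>a. (\<Prod>i\<in>insert b F. \<alpha> 1 (((\<lambda>(j, m). m(b := j)) a) i))) has_sum
      c ^ Suc (card F) / c * \<alpha> (Suc (card F)) s) (Sigma UNIV (\<lambda>j. D (s - j)))"
    using fs by (simp only: eq[abs_def])
  show ?case
    using fs' unfolding has_sum_reindex_bij_betw[OF bij, of "\<lambda>m. \<Prod>b\<in>insert b F. \<alpha> 1 (m b)"]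
    using insert.hyps by simp
qed

text \<open>Dominated convergence for series: a finite \<open>X\<close> carries all but e/3 of the
  mass of \<open>A\<close>, and on \<open>X\<close> the weights converge termwise. The limit weight
  is the same for all m, so it factors out.\<close>

lemma has_sum_weighted_limit:
  fixes A :: "'a \<Rightarrow> real" and w :: "nat \<Rightarrow> 'a \<Rightarrow> real"
  assumes A: "\<And>m. m \<in> D \<Longrightarrow> 0 \<le> A m" "(A has_sum S) D"
    and w: "\<And>N m. m \<in> D \<Longrightarrow> 0 \<le> w N m" "\<And>N m. m \<in> D \<Longrightarrow> w N m \<le> 1"
    and lim: "\<And>m. m \<in> D \<Longrightarrow> (\<lambda>N. w N m) \<longlonglongrightarrow> \<kappa>" and \<kappa>: "0 \<le> \<kappa>" "\<kappa> \<le> 1"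
    and T: "\<And>N. ((\<lambda>m. w N m * A m) has_sum T N) D"
  shows "T \<longlonglongrightarrow> \<kappa> * S"
proof (rule LIMSEQ_I)
  fix e :: real assume e: "e > 0"
  have "\<forall>\<^sub>F X in finite_subsets_at_top D. dist (sum A X) S < e / 3"
    using A(2) e unfolding has_sum_def by (intro tendstoD) auto
  then obtain X where X: "finite X" "X \<subseteq> D" and XS: "dist (sum A X) S < e / 3"
    unfolding eventually_finite_subsets_at_top by blast
  have rest: "(A has_sum S - sum A X) (D - X)"
    using X A by (intro has_sum_Diff has_sum_finite) auto
  have rest0: "0 \<le> S - sum A X"
    using has_sum_nonneg[OF rest] A(1) by auto
  with XS have rest1: "S - sum A X < e / 3" by (simp add: dist_real_def)
  have limX: "(\<lambda>N. \<Sum>m\<in>X. w N m * A m) \<longlonglongrightarrow> (\<Sum>m\<in>X. \<kappa> * A m)"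
    using X lim by (intro tendsto_sum tendsto_mult_right) auto
  obtain N0 where N0: "\<And>N. N \<ge> N0 \<Longrightarrow> norm ((\<Sum>m\<in>X. w N m * A m) - (\<Sum>m\<in>X. \<kappa> * A m)) < e / 3"
    using LIMSEQ_D[OF limX, of "e / 3"] e by auto
  show "\<exists>N0. \<forall>N\<ge>N0. norm (T N - \<kappa> * S) < e"
  proof (intro exI allI impI)
    fix N assume N: "N0 \<le> N"
    have rT: "((\<lambda>m. w N m * A m) has_sum T N - (\<Sum>m\<in>X. w N m * A m)) (D - X)"
      using X T by (intro has_sum_Diff has_sum_finite) auto
    have 1: "0 \<le> T N - (\<Sum>m\<in>X. w N m * A m)"
      using has_sum_nonneg[OF rT] A(1) w(1) by auto
    have 2: "T N - (\<Sum>m\<in>X. w N m * A m) \<le> S - sum A X"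
      using A(1) w by (intro has_sum_mono[OF rT rest]) (auto intro!: mult_left_le_one_le)
    have 3: "0 \<le> \<kappa> * (S - sum A X)" "\<kappa> * (S - sum A X) \<le> S - sum A X"
      using \<kappa> rest0 by (auto intro!: mult_left_le_one_le)
    \<comment> \<open>The two tails lie between 0 and the tail of \<open>A\<close>, since the
      weights and \<open>\<kappa>\<close> lie in [0, 1].\<close>
    have "T N - \<kappa> * S = (T N - (\<Sum>m\<in>X. w N m * A m))
        + ((\<Sum>m\<in>X. w N m * A m) - (\<Sum>m\<in>X. \<kappa> * A m)) - \<kappa> * (S - sum A X)"
      by (simp add: algebra_simps sum_distrib_left)
    then show "norm (T N - \<kappa> * S) < e"
      using 1 2 3 rest1 N0[OF N] unfolding real_norm_def by linarith
  qed
qed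

section \<open>Solving the block equations\<close>

text \<open>Back substitution: each row involves only larger pivots, so the induction adds ever
  smaller ones. \<open>C\<close> is chosen before \<open>d\<close>: the right-hand side affects only
  the offsets \<open>\<beta>\<close>, which is why the limit density will not depend on m.\<close>

lemma triangular_system_solution:
  fixes A :: "nat \<Rightarrow> nat \<Rightarrow> int"
  assumes "finite T" and F: "finite F" and "T \<inter> F = {}"
    and "\<And>t k. t \<in> T \<Longrightarrow> k \<in> T \<Longrightarrow> k \<le> t \<Longrightarrow> A t k = 0"
  shows "\<exists>C :: nat \<Rightarrow> nat \<Rightarrow> int. \<forall>d. \<exists>\<beta>. \<forall>x. (\<forall>t\<in>T. x t = (\<Sum>k\<in>F \<union> T. A t k * x k) + d t)
    \<longleftrightarrow> (\<forall>t\<in>T. x t = (\<Sum>f\<in>F. C t f * x f) + \<beta> t)"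
  using assms(1,3,4)
proof (induction T rule: finite_linorder_min_induct)
  case empty
  show ?case by simp
next
  case (insert b T)
  have b: "b \<notin> T" "b \<notin> F" using insert.hyps insert.prems(1) by auto
  obtain C :: "nat \<Rightarrow> nat \<Rightarrow> int" where C: "\<And>d. \<exists>\<beta>. \<forall>x. (\<forall>t\<in>T. x t = (\<Sum>k\<in>F \<union> T. A t k * x k) + d t)
      \<longleftrightarrow> (\<forall>t\<in>T. x t = (\<Sum>f\<in>F. C t f * x f) + \<beta> t)"
    using insert.IH insert.prems by (auto; metis)
  \<comment> \<open>Row \<open>b\<close> with the already solved larger pivots substituted; the
    other rows do not contain x b.\<close>
  define C' where "C' t f = (if t = b then A b f + (\<Sum>s\<in>T. A b s * C s f) else C t f)" for t f
  show ?case
  proof (intro exI[of _ C'] allI)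
    fix d
    obtain \<beta> where \<beta>: "\<And>x. (\<forall>t\<in>T. x t = (\<Sum>k\<in>F \<union> T. A t k * x k) + d t)
      \<longleftrightarrow> (\<forall>t\<in>T. x t = (\<Sum>f\<in>F. C t f * x f) + \<beta> t)"
      using C by blast
    define \<beta>' where "\<beta>' t = (if t = b then d b + (\<Sum>s\<in>T. A b s * \<beta> s) else \<beta> t)" for t
    have "(\<forall>t\<in>insert b T. x t = (\<Sum>k\<in>F \<union> insert b T. A t k * x k) + d t)
        \<longleftrightarrow> (\<forall>t\<in>insert b T. x t = (\<Sum>f\<in>F. C' t f * x f) + \<beta>' t)" for x
    proof -
      have ins: "(\<Sum>k\<in>F \<union> insert b T. A t k * x k) = (\<Sum>k\<in>F \<union> T. A t k * x k)"
        if "t \<in> insert b T" for t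
      proof -
        have "A t b = 0" using that insert.prems(2)[of t b] insert.hyps(2) by force
        then show ?thesis using b F insert.hyps(1) by simp
      qed
      have T: "(\<forall>t\<in>T. x t = (\<Sum>f\<in>F. C' t f * x f) + \<beta>' t) \<longleftrightarrow> (\<forall>t\<in>T. x t = (\<Sum>f\<in>F. C t f * x f) + \<beta> t)"
        using b by (intro ball_cong) (auto simp: C'_def \<beta>'_def)
      have pivot: "(\<Sum>k\<in>F \<union> T. A b k * x k) + d b = (\<Sum>f\<in>F. C' b f * x f) + \<beta>' b"
        if "\<forall>t\<in>T. x t = (\<Sum>f\<in>F. C t f * x f) + \<beta> t"
      proof -
        have "(\<Sum>k\<in>F \<union> T. A b k * x k) = (\<Sum>k\<in>F. A b k * x k) + (\<Sum>k\<in>T. A b k * x k)"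
          using F insert.hyps(1) insert.prems(1) by (intro sum.union_disjoint) auto
        also have "(\<Sum>k\<in>T. A b k * x k) = (\<Sum>s\<in>T. A b s * ((\<Sum>f\<in>F. C s f * x f) + \<beta> s))"
          using that by (intro sum.cong) auto
        also have "\<dots> = (\<Sum>s\<in>T. \<Sum>f\<in>F. A b s * C s f * x f) + (\<Sum>s\<in>T. A b s * \<beta> s)"
          by (simp add: distrib_left sum.distrib sum_distrib_left mult.assoc)
        also have "(\<Sum>s\<in>T. \<Sum>f\<in>F. A b s * C s f * x f) = (\<Sum>f\<in>F. (\<Sum>s\<in>T. A b s * C s f) * x f)"
          by (subst sum.swap) (simp add: sum_distrib_right)
        finally show ?thesis
          by (simp add: C'_def \<beta>'_def distrib_right sum.distrib)
      qed
      show ?thesis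
        using ins \<beta>[of x] T pivot by auto
    qed
    then show "\<exists>\<beta>. \<forall>x. (\<forall>t\<in>insert b T. x t = (\<Sum>k\<in>F \<union> insert b T. A t k * x k) + d t)
      \<longleftrightarrow> (\<forall>t\<in>insert b T. x t = (\<Sum>f\<in>F. C' t f * x f) + \<beta> t)" by blast
  qed
qed

text \<open>The differences cancel around the cycle, since \<open>prev_idx n\<close> permutes the
  indices.\<close>

lemma sum_block_differences_eq_0:
  fixes x :: "nat \<Rightarrow> int"
  assumes n: "n \<ge> 1" and part: "partition_on {1..n} \<rho>"
  shows "(\<Sum>B\<in>\<rho>. \<Sum>k\<in>B. x (prev_idx n k) - x k) = 0"
proof -
  have Un: "\<Union>\<rho> = {1..n}" using partition_onD1[OF part] by simp
  have fin: "finite B" if "B \<in> \<rho>" for B using Un that by (metis Sup_upper finite_atLeastAtMost finite_subset)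
  have "(\<Sum>B\<in>\<rho>. \<Sum>k\<in>B. x (prev_idx n k) - x k) = (\<Sum>k\<in>\<Union>\<rho>. x (prev_idx n k) - x k)"
    using fin partition_onD2[OF part]
    by (subst sum.Union_disjoint) (auto simp: disjoint_def)
  also have "\<dots> = (\<Sum>k\<in>{1..n}. x (prev_idx n k)) - (\<Sum>k\<in>{1..n}. x k)"
    by (simp add: Un sum_subtractf)
  also have "(\<Sum>k\<in>{1..n}. x (prev_idx n k)) = (\<Sum>k\<in>{1..n}. x k)"
    by (rule sum.reindex_bij_witness[of _ "\<lambda>k. if k = n then 1 else Suc k" "prev_idx n"])
      (use n in \<open>auto simp: prev_idx_def\<close>)
  finally show ?thesis by simp
qed

text \<open>The blocks form a tree rooted at the block of \<open>1\<close>: the parent of a block \<open>B\<close> is the block of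
  \<open>Min B - 1\<close>, which has a smaller minimum. The variables \<open>Min B - 1\<close> are therefore pivots
  of a triangular system, and the equation of the root follows from the others because the
  block sums add up to zero.\<close>

lemma block_system_solution:
  assumes n: "n \<ge> 1" and part: "partition_on {1..n} \<rho>"
  obtains F T :: "nat set" and C :: "nat \<Rightarrow> nat \<Rightarrow> int" where
    "F \<union> T = {1..n}" "F \<inter> T = {}" "Suc (card T) = card \<rho>"
    "\<forall>t\<in>T. (\<Sum>f\<in>F. C t f) = 1"
    "\<forall>m. (\<Sum>B\<in>\<rho>. m B) = 0 \<longrightarrow> (\<exists>\<beta>. \<forall>x :: nat \<Rightarrow> int.
       (\<forall>B\<in>\<rho>. (\<Sum>k\<in>B. x (prev_idx n k) - x k) = m B) \<longleftrightarrow> (\<forall>t\<in>T. x t = (\<Sum>f\<in>F. C t f * x f) + \<beta> t))"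
proof -
  define E :: "nat set \<Rightarrow> (nat \<Rightarrow> int) \<Rightarrow> int" where "E B x = (\<Sum>k\<in>B. x (prev_idx n k) - x k)" for B x
  define nxt where "nxt k = (if k = n then 1 else Suc k)" for k
  \<comment> \<open>Coefficient of x k in the block sum: x k enters positively through its cyclic
    successor and negatively through k itself.\<close>
  define e :: "nat set \<Rightarrow> nat \<Rightarrow> int" where "e B k = of_bool (nxt k \<in> B) - of_bool (k \<in> B)" for B k
  have Un: "\<Union>\<rho> = {1..n}" using partition_onD1[OF part] by simp
  have disj: "B = B'" if "B \<in> \<rho>" "B' \<in> \<rho>" "k \<in> B" "k \<in> B'" for B B' k
    using partition_onD2[OF part] that by (auto simp: disjoint_def)
  have sub: "B \<subseteq> {1..n}" if "B \<in> \<rho>" for B using Un that by auto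
  have fin: "finite B" if "B \<in> \<rho>" for B using sub[OF that] finite_subset by blast
  have ne: "B \<noteq> {}" if "B \<in> \<rho>" for B using partition_onD3[OF part] that by auto
  have fin\<rho>: "finite \<rho>" using part finite_elements by blast
  have perm: "(\<Sum>k\<in>{1..n}. g (prev_idx n k) k) = (\<Sum>k\<in>{1..n}. g k (nxt k))" for g :: "nat \<Rightarrow> nat \<Rightarrow> int"
    by (rule sum.reindex_bij_witness[of _ nxt "prev_idx n"]) (use n in \<open>auto simp: nxt_def prev_idx_def\<close>)
  have E_coeff: "E B x = (\<Sum>k\<in>{1..n}. e B k * x k)" if "B \<in> \<rho>" for B x
  proof -
    have "E B x = (\<Sum>k\<in>{1..n}. of_bool (k \<in> B) * (x (prev_idx n k) - x k))"
      unfolding E_def using sub[OF that] by (intro sum.mono_neutral_cong_left) auto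
    also have "\<dots> = (\<Sum>k\<in>{1..n}. of_bool (k \<in> B) * x (prev_idx n k)) - (\<Sum>k\<in>{1..n}. of_bool (k \<in> B) * x k)"
      by (simp add: right_diff_distrib sum_subtractf)
    also have "(\<Sum>k\<in>{1..n}. of_bool (k \<in> B) * x (prev_idx n k)) = (\<Sum>k\<in>{1..n}. of_bool (nxt k \<in> B) * x k)"
      by (rule perm[of "\<lambda>a b. of_bool (b \<in> B) * x a"])
    finally show ?thesis by (simp add: e_def left_diff_distrib sum_subtractf)
  qed
  have E_total: "(\<Sum>B\<in>\<rho>. E B x) = 0" for x
    unfolding E_def by (rule sum_block_differences_eq_0[OF n part])
  have "1 \<in> \<Union>\<rho>" unfolding Un using n by simp
  then obtain R where R: "R \<in> \<rho>" "1 \<in> R" by blast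
  have MinB: "Min B \<in> B" "2 \<le> Min B" "Min B \<le> n" "\<And>k. k \<in> B \<Longrightarrow> Min B \<le> k" if "B \<in> \<rho> - {R}" for B
  proof -
    show MB: "Min B \<in> B" using that fin ne by auto
    then have "Min B \<in> {1..n}" using that sub[of B] by blast
    moreover have "Min B \<noteq> 1" using MB R that by (metis DiffE disj insertI1)
    ultimately show "2 \<le> Min B" "Min B \<le> n" by auto
    show "\<And>k. k \<in> B \<Longrightarrow> Min B \<le> k" using that fin by auto
  qed
  define T where "T = (\<lambda>B. Min B - 1) ` (\<rho> - {R})"
  define F where "F = {1..n} - T"
  have inj: "inj_on (\<lambda>B. Min B - 1) (\<rho> - {R})"
  proof (rule inj_onI)
    fix B B' assume B: "B \<in> \<rho> - {R}" "B' \<in> \<rho> - {R}" "Min B - 1 = Min B' - 1"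
    then have "Min B = Min B'" using MinB(2)[of B] MinB(2)[of B'] by simp
    then show "B = B'" using MinB(1)[of B] MinB(1)[of B'] B by (metis DiffE disj)
  qed
  have cardT: "Suc (card T) = card \<rho>"
    unfolding T_def card_image[OF inj] using R(1) fin\<rho> by (rule card.remove[symmetric, rotated])
  have T_sub: "T \<subseteq> {1..n}"
  proof
    fix t assume "t \<in> T"
    then obtain B where "B \<in> \<rho> - {R}" "t = Min B - 1" by (auto simp: T_def)
    then show "t \<in> {1..n}" using MinB(2,3)[of B] by auto
  qed
  have FT: "F \<union> T = {1..n}" "F \<inter> T = {}" "finite F" "finite T"
    using T_sub by (auto simp: F_def intro: finite_subset)
  define blk where "blk = the_inv_into (\<rho> - {R}) (\<lambda>B. Min B - 1)"
  have blk: "blk (Min B - 1) = B" if "B \<in> \<rho> - {R}" for B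
    unfolding blk_def using the_inv_into_f_f[OF inj that] .
  \<comment> \<open>Adding x t to both sides of the block equation isolates the pivot on the
    left.\<close>
  define A :: "nat \<Rightarrow> nat \<Rightarrow> int" where "A t k = of_bool (k = t) - e (blk t) k" for t k
  \<comment> \<open>The triangular shape: an index below Min B lies outside B, and its successor
    lies in B only if it is Min B itself, so the pivot has coefficient 1 and smaller variables have
    coefficient 0.\<close>
  have e_below: "e B k = of_bool (k = Min B - 1)" if "B \<in> \<rho> - {R}" "k \<le> Min B - 1" for B k
  proof -
    have "k \<notin> B" using MinB(4)[OF that(1), of k] MinB(2)[OF that(1)] that(2) by fastforce
    moreover have "nxt k = Suc k" using MinB(2,3)[OF that(1)] that(2) by (auto simp: nxt_def)
    moreover have "Suc k \<in> B \<longleftrightarrow> k = Min B - 1"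
      using MinB(1,2)[OF that(1)] MinB(4)[OF that(1), of "Suc k"] that(2) by (auto simp: Suc_le_eq)
    ultimately show ?thesis by (simp add: e_def)
  qed
  have A0: "A t k = 0" if t: "t \<in> T" and k: "k \<le> t" for t k
  proof -
    obtain B where B: "B \<in> \<rho> - {R}" "t = Min B - 1" using t unfolding T_def by blast
    then show ?thesis using k e_below[of B k] blk[of B] by (simp add: A_def)
  qed
  have TF: "T \<inter> F = {}" using FT(2) by blast
  obtain C :: "nat \<Rightarrow> nat \<Rightarrow> int" where C: "\<And>d. \<exists>\<beta>. \<forall>x. (\<forall>t\<in>T. x t = (\<Sum>k\<in>F \<union> T. A t k * x k) + d t)
      \<longleftrightarrow> (\<forall>t\<in>T. x t = (\<Sum>f\<in>F. C t f * x f) + \<beta> t)"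
    using triangular_system_solution[OF FT(4,3) TF, of A] A0 by blast
  have pivot_eq: "x (Min B - 1) = (\<Sum>k\<in>F \<union> T. A (Min B - 1) k * x k) + m B \<longleftrightarrow> E B x = m B"
    if B: "B \<in> \<rho> - {R}" for B m x
  proof -
    have in_n: "Min B - 1 \<in> {1..n}" using B T_sub by (auto simp: T_def)
    have "(\<Sum>k\<in>F \<union> T. A (Min B - 1) k * x k)
        = (\<Sum>k\<in>{1..n}. of_bool (k = Min B - 1) * x k) - (\<Sum>k\<in>{1..n}. e B k * x k)"
      unfolding FT(1) A_def blk[OF B] by (simp add: left_diff_distrib sum_subtractf)
    also have "(\<Sum>k\<in>{1..n}. of_bool (k = Min B - 1) * x k) = x (Min B - 1)"
    proof -
      have "(\<Sum>k\<in>{1..n}. of_bool (k = Min B - 1) * x k) = (\<Sum>k\<in>{1..n}. if k = Min B - 1 then x k else 0)"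
        by (intro sum.cong) auto
      then show ?thesis using in_n by (simp only: sum.delta finite_atLeastAtMost if_True)
    qed
    finally show ?thesis using E_coeff[of B x] B by auto
  qed
  have ball_T: "(\<forall>t\<in>T. P t) \<longleftrightarrow> (\<forall>B\<in>\<rho> - {R}. P (Min B - 1))" for P
    unfolding T_def by blast
  have main: "\<exists>\<beta>. \<forall>x :: nat \<Rightarrow> int. (\<forall>B\<in>\<rho>. E B x = m B) \<longleftrightarrow> (\<forall>t\<in>T. x t = (\<Sum>f\<in>F. C t f * x f) + \<beta> t)"
    if m: "(\<Sum>B\<in>\<rho>. m B) = 0" for m
  proof -
    obtain \<beta> where \<beta>: "\<And>x. (\<forall>t\<in>T. x t = (\<Sum>k\<in>F \<union> T. A t k * x k) + m (blk t))
        \<longleftrightarrow> (\<forall>t\<in>T. x t = (\<Sum>f\<in>F. C t f * x f) + \<beta> t)"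
      using C[of "\<lambda>t. m (blk t)"] by blast
    have "(\<forall>B\<in>\<rho>. E B x = m B) \<longleftrightarrow> (\<forall>t\<in>T. x t = (\<Sum>k\<in>F \<union> T. A t k * x k) + m (blk t))" for x
    proof -
      have "(\<forall>t\<in>T. x t = (\<Sum>k\<in>F \<union> T. A t k * x k) + m (blk t)) \<longleftrightarrow> (\<forall>B\<in>\<rho> - {R}. E B x = m B)"
      proof -
        have "(\<forall>t\<in>T. x t = (\<Sum>k\<in>F \<union> T. A t k * x k) + m (blk t)) \<longleftrightarrow>
            (\<forall>B\<in>\<rho> - {R}. x (Min B - 1) = (\<Sum>k\<in>F \<union> T. A (Min B - 1) k * x k) + m (blk (Min B - 1)))"
          by (rule ball_T)
        also have "\<dots> \<longleftrightarrow> (\<forall>B\<in>\<rho> - {R}. E B x = m B)"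
          using pivot_eq[where x = x and m = m] by (intro ball_cong refl) (simp only: blk)
        finally show ?thesis .
      qed
      moreover have "E R x = m R" if "\<forall>B\<in>\<rho> - {R}. E B x = m B"
      proof -
        have "E R x + (\<Sum>B\<in>\<rho> - {R}. E B x) = m R + (\<Sum>B\<in>\<rho> - {R}. m B)"
          using E_total[of x] m sum.remove[OF fin\<rho> R(1), of "\<lambda>B. E B x"] sum.remove[OF fin\<rho> R(1), of m]
          by linarith
        moreover have "(\<Sum>B\<in>\<rho> - {R}. E B x) = (\<Sum>B\<in>\<rho> - {R}. m B)"
          using that by (intro sum.cong) auto
        ultimately show ?thesis by simp
      qed
      ultimately show ?thesis by blast
    qed
    with \<beta> show ?thesis by blast
  qed
  \<comment> \<open>Constant vectors solve the homogeneous system: the zero vector forces every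
    \<open>\<beta> t\<close> to be 0, and the all-ones vector then gives the row sum.\<close>
  have rows: "(\<Sum>f\<in>F. C t f) = 1" if t: "t \<in> T" for t
  proof -
    obtain \<beta> where \<beta>: "\<And>x :: nat \<Rightarrow> int. (\<forall>B\<in>\<rho>. E B x = 0) \<longleftrightarrow> (\<forall>t\<in>T. x t = (\<Sum>f\<in>F. C t f * x f) + \<beta> t)"
      using main[of "\<lambda>_. 0"] by auto
    show ?thesis
      using \<beta>[of "\<lambda>_. 0"] \<beta>[of "\<lambda>_. 1"] t by (simp add: E_def)
  qed
  show ?thesis
  proof (rule that[OF FT(1,2) cardT])
    show "\<forall>t\<in>T. (\<Sum>f\<in>F. C t f) = 1" using rows by blast
  qed (intro allI impI main[unfolded E_def])
qed

section \<open>Lattice point densities in the unit cube\<close>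

text \<open>Half-open sides make the cube a disjoint union of cells on which the coordinates of N x
  round up to constants in {1..N}.\<close>

definition unit_cube :: "nat set \<Rightarrow> (nat \<Rightarrow> real) measure" where
  "unit_cube F = Pi\<^sub>M F (\<lambda>_. restrict_space lborel {0<..1})"

lemma space_unit_cube: "space (unit_cube F) = Pi\<^sub>E F (\<lambda>_. {0<..1})"
  by (simp add: unit_cube_def space_PiM space_restrict_space)

lemma product_sigma_finite_unit: "product_sigma_finite (\<lambda>_ :: nat. restrict_space lborel {0<..1::real})"
proof -
  have "finite_measure (restrict_space lborel {0<..1::real})"
    by (rule finite_measureI) (auto simp: emeasure_restrict_space space_restrict_space)
  then have "sigma_finite_measure (restrict_space lborel {0<..1::real})"
    by (rule finite_measure.axioms(1))
  then show ?thesis by (intro product_sigma_finite.intro)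
qed

lemma emeasure_unit_cube_box:
  assumes "finite F" "\<And>f. f \<in> F \<Longrightarrow> A f \<in> sets borel" "\<And>f. f \<in> F \<Longrightarrow> A f \<subseteq> {0<..1}"
  shows "emeasure (unit_cube F) (Pi\<^sub>E F A) = (\<Prod>f\<in>F. emeasure lborel (A f))"
proof -
  interpret product_sigma_finite "\<lambda>_ :: nat. restrict_space lborel {0<..1::real}"
    by (rule product_sigma_finite_unit)
  have "emeasure (unit_cube F) (Pi\<^sub>E F A) = (\<Prod>f\<in>F. emeasure (restrict_space lborel {0<..1}) (A f))"
    unfolding unit_cube_def using assms
    by (intro emeasure_PiM) (auto simp: sets_restrict_space_iff)
  also have "\<dots> = (\<Prod>f\<in>F. emeasure lborel (A f))"
    using assms by (intro prod.cong) (auto simp: emeasure_restrict_space)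
  finally show ?thesis .
qed

lemma finite_measure_unit_cube:
  assumes "finite F"
  shows "finite_measure (unit_cube F)"
proof (rule finite_measureI)
  have "emeasure (unit_cube F) (space (unit_cube F)) = (\<Prod>f\<in>F. emeasure lborel {0<..1::real})"
    unfolding space_unit_cube by (rule emeasure_unit_cube_box) (use assms in auto)
  then show "emeasure (unit_cube F) (space (unit_cube F)) \<noteq> \<infinity>" by simp
qed

lemma measurable_unit_cube_component:
  assumes "f \<in> F"
  shows "(\<lambda>x. x f) \<in> borel_measurable (unit_cube F)"
proof -
  have "(\<lambda>x. x) \<in> borel_measurable (restrict_space lborel {0<..1::real})"
    by (intro measurable_restrict_space1) simp
  from measurable_compose[OF measurable_component_singleton[OF assms] this] show ?thesis
    by (simp add: unit_cube_def)
qed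

text \<open>Fubini in the coordinate \<open>f0\<close>: once the others are fixed, its nonzero
  coefficient leaves at most one admissible value.\<close>

lemma AE_unit_cube_not_hyperplane:
  fixes c :: "nat \<Rightarrow> real"
  assumes F: "finite F" and f0: "f0 \<in> F" "c f0 \<noteq> 0"
  shows "AE x in unit_cube F. (\<Sum>f\<in>F. c f * x f) \<noteq> v"
proof -
  interpret product_sigma_finite "\<lambda>_ :: nat. restrict_space lborel {0<..1::real}"
    by (rule product_sigma_finite_unit)
  define I where "I = F - {f0}"
  have I: "finite I" "f0 \<notin> I" "insert f0 I = F" using F f0 by (auto simp: I_def)
  define H where "H = {x \<in> space (unit_cube F). (\<Sum>f\<in>F. c f * x f) = v}"
  have H [measurable]: "H \<in> sets (unit_cube F)"
  proof -
    have [measurable]: "(\<lambda>x. \<Sum>f\<in>F. c f * x f) \<in> borel_measurable (unit_cube F)"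
      by (intro borel_measurable_sum borel_measurable_times borel_measurable_const measurable_unit_cube_component)
    show ?thesis unfolding H_def by measurable
  qed
  have "emeasure (unit_cube F) H = (\<integral>\<^sup>+x. indicator H x \<partial>unit_cube F)"
    by simp
  also have "\<dots> = (\<integral>\<^sup>+x. (\<integral>\<^sup>+y. indicator H (x(f0 := y)) \<partial>restrict_space lborel {0<..1}) \<partial>unit_cube I)"
    unfolding unit_cube_def I(3)[symmetric]
    by (rule product_nn_integral_insert[OF I(1,2)])
      (use H in \<open>simp add: unit_cube_def I(3)\<close>)
  also have "\<dots> = (\<integral>\<^sup>+x. 0 \<partial>unit_cube I)"
  proof (intro nn_integral_cong)
    fix x
    define y0 where "y0 = (v - (\<Sum>f\<in>I. c f * x f)) / c f0"
    have only: "y = y0" if "x(f0 := y) \<in> H" for y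
    proof -
      have "(\<Sum>f\<in>I. c f * (x(f0 := y)) f) = (\<Sum>f\<in>I. c f * x f)"
        using I(2) by (intro sum.cong) auto
      then have "c f0 * y + (\<Sum>f\<in>I. c f * x f) = v"
        using that I unfolding H_def I(3)[symmetric] by simp
      then show ?thesis using f0 by (simp add: y0_def field_simps)
    qed
    have "(\<integral>\<^sup>+y. indicator H (x(f0 := y)) \<partial>restrict_space lborel {0<..1})
        = (\<integral>\<^sup>+y. indicator H (x(f0 := y)) * indicator {0<..1} y \<partial>lborel)"
      by (subst nn_integral_restrict_space) auto
    also have "\<dots> \<le> (\<integral>\<^sup>+y. indicator {y0} y \<partial>lborel)"
    proof (rule nn_integral_mono)
      show "indicator H (x(f0 := y)) * indicator {0<..1} y \<le> (indicator {y0} y :: ennreal)" for y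
        using only[of y] by (auto simp: indicator_def)
    qed
    also have "\<dots> = 0" by simp
    finally show "(\<integral>\<^sup>+y. indicator H (x(f0 := y)) \<partial>restrict_space lborel {0<..1}) = 0"
      by simp
  qed
  finally have "emeasure (unit_cube F) H = 0" by simp
  then show ?thesis
    using H by (intro AE_I[of _ _ H]) (auto simp: H_def)
qed

lemma ceiling_mult_div_tendsto:
  fixes x :: real
  shows "(\<lambda>N. real_of_int \<lceil>real N * x\<rceil> / real N) \<longlonglongrightarrow> x"
proof (rule real_tendsto_sandwich)
  show "\<forall>\<^sub>F N in sequentially. x \<le> real_of_int \<lceil>real N * x\<rceil> / real N"
    using eventually_gt_at_top[of 0]
    by eventually_elim (simp add: pos_le_divide_eq mult.commute)
  show "\<forall>\<^sub>F N in sequentially. real_of_int \<lceil>real N * x\<rceil> / real N \<le> x + inverse (real N)"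
    using eventually_gt_at_top[of 0]
  proof eventually_elim
    case (elim N)
    have "real_of_int \<lceil>real N * x\<rceil> \<le> real N * x + 1" by linarith
    then show ?case using elim by (simp add: field_simps)
  qed
  show "(\<lambda>N. x + inverse (real N)) \<longlonglongrightarrow> x"
    using tendsto_add[OF tendsto_const lim_inverse_n, of x] by simp
qed simp

text \<open>Only free coordinates are listed; the condition says that the pivots computed from them
  stay in the index range.\<close>

definition lattice_points :: "nat set \<Rightarrow> nat set \<Rightarrow> (nat \<Rightarrow> nat \<Rightarrow> int) \<Rightarrow> (nat \<Rightarrow> int) \<Rightarrow> nat \<Rightarrow> (nat \<Rightarrow> nat) set" where
  "lattice_points F T C \<beta> N = {y \<in> Pi\<^sub>E F (\<lambda>_. {1..N}).
     \<forall>t\<in>T. (\<Sum>f\<in>F. C t f * int (y f)) + \<beta> t \<in> {1..int N}}"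

lemma card_lattice_points_le:
  "finite F \<Longrightarrow> card (lattice_points F T C \<beta> N) \<le> N ^ card F"
  using card_mono[of "Pi\<^sub>E F (\<lambda>_. {1..N})" "lattice_points F T C \<beta> N"]
  by (auto simp: lattice_points_def card_PiE finite_PiE)

text \<open>Rounding up turns each lattice point into a cell of volume N^(-card F). The identity is
  exact, so the count becomes the measure of a set in a space independent of N, ready for dominated
  convergence.\<close>

lemma lattice_points_measure:
  assumes F: "finite F" and N: "N \<ge> 1"
  shows "measure (unit_cube F) {x \<in> space (unit_cube F).
      \<forall>t\<in>T. (\<Sum>f\<in>F. C t f * \<lceil>real N * x f\<rceil>) + \<beta> t \<in> {1..int N}}
    = real (card (lattice_points F T C \<beta> N)) / real N ^ card F"
proof -
  interpret finite_measure "unit_cube F" using F by (rule finite_measure_unit_cube)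
  define cell where "cell y = Pi\<^sub>E F (\<lambda>f. {(real (y f) - 1) / real N<..real (y f) / real N})" for y :: "nat \<Rightarrow> nat"
  let ?Y = "lattice_points F T C \<beta> N"
  have finY: "finite ?Y"
    using F by (auto simp: lattice_points_def finite_PiE)
  have in_unit: "{(real k - 1) / real N<..real k / real N} \<subseteq> {0<..1}" if "k \<in> {1..N}" for k
  proof
    fix z assume z: "z \<in> {(real k - 1) / real N<..real k / real N}"
    have "0 \<le> (real k - 1) / real N" "real k / real N \<le> 1" using that by auto
    with z show "z \<in> {0<..1}" by auto
  qed
  have ceil: "z \<in> {(real k - 1) / real N<..real k / real N} \<longleftrightarrow> \<lceil>real N * z\<rceil> = int k" for z k
    using N by (auto simp: ceiling_eq_iff field_simps)
  have cell_measure: "emeasure (unit_cube F) (cell y) = ennreal (1 / real N ^ card F)" if "y \<in> ?Y" for y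
  proof -
    have y: "y f \<in> {1..N}" if "f \<in> F" for f using \<open>y \<in> ?Y\<close> that by (auto simp: lattice_points_def)
    have "emeasure (unit_cube F) (cell y) = (\<Prod>f\<in>F. emeasure lborel {(real (y f) - 1) / real N<..real (y f) / real N})"
      unfolding cell_def using in_unit y by (intro emeasure_unit_cube_box F) auto
    also have "\<dots> = (\<Prod>f\<in>F. ennreal (1 / real N))"
      using N by (intro prod.cong refl) (simp add: divide_right_mono diff_divide_distrib)
    finally show ?thesis by (simp add: ennreal_power power_one_over)
  qed
  \<comment> \<open>A nonmeasurable set has \<open>emeasure\<close> 0 by convention, whereas a cell
    has positive measure.\<close>
  have cell_sets: "cell y \<in> sets (unit_cube F)" if "y \<in> ?Y" for y
  proof (rule ccontr)
    assume "cell y \<notin> sets (unit_cube F)"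
    then have "emeasure (unit_cube F) (cell y) = 0" by (rule emeasure_notin_sets)
    then show False using cell_measure[OF that] N by simp
  qed
  have disj: "disjoint_family_on cell ?Y"
    unfolding disjoint_family_on_def
  proof (intro ballI impI)
    fix y y' assume y: "y \<in> ?Y" "y' \<in> ?Y" "y \<noteq> y'"
    then have "y \<in> Pi\<^sub>E F (\<lambda>_. {1..N})" "y' \<in> Pi\<^sub>E F (\<lambda>_. {1..N})"
      by (auto simp: lattice_points_def)
    from PiE_ext[OF this] y(3) obtain f where f: "f \<in> F" "y f \<noteq> y' f" by blast
    show "cell y \<inter> cell y' = {}"
    proof (rule equals0I)
      fix x assume "x \<in> cell y \<inter> cell y'"
      then have "\<lceil>real N * x f\<rceil> = int (y f)" "\<lceil>real N * x f\<rceil> = int (y' f)"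
        unfolding ceil[symmetric] using f(1) by (simp_all add: cell_def PiE_iff)
      then show False using f(2) by simp
    qed
  qed
  have "{x \<in> space (unit_cube F). \<forall>t\<in>T. (\<Sum>f\<in>F. C t f * \<lceil>real N * x f\<rceil>) + \<beta> t \<in> {1..int N}} = (\<Union>y\<in>?Y. cell y)"
    (is "?S = _")
  proof (intro equalityI subsetI)
    fix x assume x: "x \<in> ?S"
    define y where "y = (\<lambda>f\<in>F. nat \<lceil>real N * x f\<rceil>)"
    have pos: "1 \<le> \<lceil>real N * x f\<rceil>" "\<lceil>real N * x f\<rceil> \<le> int N" if "f \<in> F" for f
    proof -
      have "0 < x f" "x f \<le> 1" using x that by (auto simp: space_unit_cube PiE_iff)
      then have "0 < real N * x f" "real N * x f \<le> real N" using N by (auto simp: mult_left_le)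
      then show "1 \<le> \<lceil>real N * x f\<rceil>" "\<lceil>real N * x f\<rceil> \<le> int N" by (simp_all add: ceiling_le_iff)
    qed
    have yf: "int (y f) = \<lceil>real N * x f\<rceil>" if "f \<in> F" for f
      using pos(1)[OF that] that by (simp add: y_def)
    have "y f \<in> {1..N}" if "f \<in> F" for f
      using pos[OF that] yf[OF that] by (simp only: atLeastAtMost_iff) linarith
    then have "y \<in> Pi\<^sub>E F (\<lambda>_. {1..N})"
      by (auto simp: PiE_iff y_def)
    moreover have "(\<Sum>f\<in>F. C t f * int (y f)) = (\<Sum>f\<in>F. C t f * \<lceil>real N * x f\<rceil>)" for t
      using yf by (intro sum.cong) auto
    ultimately have "y \<in> ?Y" using x by (simp add: lattice_points_def)
    moreover have "x \<in> cell y"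
      using x yf ceil by (auto simp: cell_def space_unit_cube PiE_iff)
    ultimately show "x \<in> (\<Union>y\<in>?Y. cell y)" by blast
  next
    fix x assume "x \<in> (\<Union>y\<in>?Y. cell y)"
    then obtain y where y: "y \<in> ?Y" "x \<in> cell y" by blast
    have yf: "\<lceil>real N * x f\<rceil> = int (y f)" if "f \<in> F" for f
      using y(2) that ceil by (auto simp: cell_def PiE_iff)
    have "(\<Sum>f\<in>F. C t f * int (y f)) = (\<Sum>f\<in>F. C t f * \<lceil>real N * x f\<rceil>)" for t
      using yf by (intro sum.cong) auto
    moreover have "x \<in> space (unit_cube F)"
      using sets.sets_into_space[OF cell_sets[OF y(1)]] y(2) by blast
    ultimately show "x \<in> ?S" using y(1) by (simp add: lattice_points_def)
  qed
  then have "measure (unit_cube F) ?S = (\<Sum>y\<in>?Y. measure (unit_cube F) (cell y))"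
    using finite_measure_finite_Union[OF finY _ disj] cell_sets by auto
  also have "\<dots> = (\<Sum>y\<in>?Y. 1 / real N ^ card F)"
    by (intro sum.cong) (auto simp: measure_def cell_measure)
  finally show ?thesis by simp
qed

text \<open>After division by N the rounding and the offset \<open>\<beta>\<close> disappear, so the
  indicators converge to that of the polytope 0 < L t x < 1, except possibly on its bounding
  hyperplanes. Hence one \<open>\<kappa>\<close> serves all \<open>\<beta>\<close>.\<close>

lemma lattice_points_density:
  assumes F: "finite F" and T: "finite T"
    and rows: "\<And>t. t \<in> T \<Longrightarrow> (\<Sum>f\<in>F. C t f) = 1"
  obtains \<kappa> where
    "\<And>\<beta>. (\<lambda>N. real (card (lattice_points F T C \<beta> N)) / real N ^ card F) \<longlonglongrightarrow> \<kappa>"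
proof -
  interpret finite_measure "unit_cube F" using F by (rule finite_measure_unit_cube)
  define L where "L t x = (\<Sum>f\<in>F. real_of_int (C t f) * x f)" for t and x :: "nat \<Rightarrow> real"
  define S where "S \<beta> N = {x \<in> space (unit_cube F).
      \<forall>t\<in>T. (\<Sum>f\<in>F. C t f * \<lceil>real N * x f\<rceil>) + \<beta> t \<in> {1..int N}}" for \<beta> and N :: nat
  define Q where "Q = {x \<in> space (unit_cube F). \<forall>t\<in>T. 0 < L t x \<and> L t x < 1}"
  have L_meas [measurable]: "(\<lambda>x. L t x) \<in> borel_measurable (unit_cube F)" for t
    unfolding L_def
    by (intro borel_measurable_sum borel_measurable_times borel_measurable_const measurable_unit_cube_component)
  have Q [measurable]: "Q \<in> sets (unit_cube F)"
    unfolding Q_def using T by measurable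
  have S [measurable]: "S \<beta> N \<in> sets (unit_cube F)" for \<beta> N
  proof -
    have eq: "(\<Sum>f\<in>F. C t f * \<lceil>real N * x f\<rceil>) + \<beta> t \<in> {1..int N}
        \<longleftrightarrow> 1 \<le> (\<Sum>f\<in>F. real_of_int (C t f) * real_of_int \<lceil>real N * x f\<rceil>) + real_of_int (\<beta> t)
          \<and> (\<Sum>f\<in>F. real_of_int (C t f) * real_of_int \<lceil>real N * x f\<rceil>) + real_of_int (\<beta> t) \<le> real N" for t x
    proof -
      have "(\<Sum>f\<in>F. real_of_int (C t f) * real_of_int \<lceil>real N * x f\<rceil>) + real_of_int (\<beta> t)
          = real_of_int ((\<Sum>f\<in>F. C t f * \<lceil>real N * x f\<rceil>) + \<beta> t)" by simp
      then show ?thesis by (simp only: atLeastAtMost_iff) linarith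
    qed
    have ceil: "(\<lambda>x. real_of_int \<lceil>real N * x f\<rceil>) \<in> borel_measurable (unit_cube F)" if "f \<in> F" for f
      by (rule measurable_compose[OF measurable_unit_cube_component[OF that]]) measurable
    have [measurable]: "(\<lambda>x. (\<Sum>f\<in>F. real_of_int (C t f) * real_of_int \<lceil>real N * x f\<rceil>) + real_of_int (\<beta> t))
        \<in> borel_measurable (unit_cube F)" for t
      by (intro borel_measurable_add borel_measurable_sum borel_measurable_times borel_measurable_const ceil)
    show ?thesis unfolding S_def eq using T by measurable
  qed
  \<comment> \<open>Row sum 1 guarantees a nonzero coefficient, so both bounding hyperplanes are
    proper and null.\<close>
  have off: "AE x in unit_cube F. \<forall>t\<in>T. L t x \<noteq> 0 \<and> L t x \<noteq> 1"
  proof (rule AE_finite_allI[OF T])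
    fix t assume "t \<in> T"
    then have "(\<Sum>f\<in>F. C t f) \<noteq> 0" using rows by simp
    then obtain f0 where "f0 \<in> F" "C t f0 \<noteq> 0" by (metis sum.neutral)
    then have "AE x in unit_cube F. L t x \<noteq> v" for v
      unfolding L_def by (intro AE_unit_cube_not_hyperplane[OF F]) auto
    from this[of 0] this[of 1] show "AE x in unit_cube F. L t x \<noteq> 0 \<and> L t x \<noteq> 1"
      by eventually_elim simp
  qed
  have "(\<lambda>N. real (card (lattice_points F T C \<beta> N)) / real N ^ card F) \<longlonglongrightarrow> measure (unit_cube F) Q" for \<beta>
  proof -
    have pt: "(\<lambda>N. indicator (S \<beta> N) x :: real) \<longlonglongrightarrow> indicator Q x"
      if x: "x \<in> space (unit_cube F)" and xt: "\<forall>t\<in>T. L t x \<noteq> 0 \<and> L t x \<noteq> 1" for x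
    proof -
      define s where "s t N = (\<Sum>f\<in>F. C t f * \<lceil>real N * x f\<rceil>) + \<beta> t" for t and N :: nat
      have s_lim: "(\<lambda>N. real_of_int (s t N) / real N) \<longlonglongrightarrow> L t x" for t
      proof -
        have "(\<lambda>N. (\<Sum>f\<in>F. real_of_int (C t f) * (real_of_int \<lceil>real N * x f\<rceil> / real N))
            + real_of_int (\<beta> t) * inverse (real N)) \<longlonglongrightarrow> L t x + real_of_int (\<beta> t) * 0"
          unfolding L_def
          by (intro tendsto_add tendsto_sum tendsto_mult tendsto_const ceiling_mult_div_tendsto lim_inverse_n)
        moreover have "(\<lambda>N. (\<Sum>f\<in>F. real_of_int (C t f) * (real_of_int \<lceil>real N * x f\<rceil> / real N))
            + real_of_int (\<beta> t) * inverse (real N)) = (\<lambda>N. real_of_int (s t N) / real N)"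
          by (simp add: s_def fun_eq_iff distrib_right sum_distrib_right divide_inverse mult.assoc)
        ultimately show ?thesis by simp
      qed
      have ev: "\<forall>\<^sub>F N in sequentially. s t N \<in> {1..int N} \<longleftrightarrow> 0 < L t x \<and> L t x < 1" if t: "t \<in> T" for t
      proof -
        consider "L t x < 0" | "0 < L t x \<and> L t x < 1" | "1 < L t x"
          using xt t by fastforce
        then show ?thesis
        proof cases
          case 1
          with order_tendstoD(2)[OF s_lim, of t 0]
          have "\<forall>\<^sub>F N in sequentially. real_of_int (s t N) / real N < 0" by auto
          then show ?thesis
            by eventually_elim (use 1 in \<open>auto simp: divide_less_0_iff\<close>)
        next
          case 2
          with order_tendstoD(1)[OF s_lim, of 0 t] order_tendstoD(2)[OF s_lim, of t 1]
          have "\<forall>\<^sub>F N in sequentially. 0 < real_of_int (s t N) / real N"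
            "\<forall>\<^sub>F N in sequentially. real_of_int (s t N) / real N < 1" by auto
          then show ?thesis
            using eventually_gt_at_top[of 0]
          proof eventually_elim
            case (elim N)
            then have "0 < s t N" "real_of_int (s t N) < real_of_int (int N)"
              by (auto simp: zero_less_divide_iff divide_less_eq)
            then have "s t N \<in> {1..int N}" by (auto simp only: of_int_less_iff atLeastAtMost_iff)
            then show ?case using 2 by simp
          qed
        next
          case 3
          with order_tendstoD(1)[OF s_lim, of 1 t]
          have "\<forall>\<^sub>F N in sequentially. 1 < real_of_int (s t N) / real N" by auto
          then show ?thesis
            using eventually_gt_at_top[of 0]
          proof eventually_elim
            case (elim N)
            then have "real_of_int (int N) < real_of_int (s t N)"
              by (auto simp: less_divide_eq)
            then have "s t N \<notin> {1..int N}" by (simp only: of_int_less_iff) simp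
            then show ?case using 3 by simp
          qed
        qed
      qed
      have "\<forall>\<^sub>F N in sequentially. \<forall>t\<in>T. s t N \<in> {1..int N} \<longleftrightarrow> 0 < L t x \<and> L t x < 1"
        using ev T by (simp add: eventually_ball_finite_distrib)
      then have "\<forall>\<^sub>F N in sequentially. (indicator (S \<beta> N) x :: real) = indicator Q x"
        by eventually_elim (use x in \<open>auto simp: S_def Q_def s_def indicator_def\<close>)
      then show ?thesis by (rule tendsto_eventually)
    qed
    have "(\<lambda>N. LINT x|unit_cube F. indicator (S \<beta> N) x :: real) \<longlonglongrightarrow> (LINT x|unit_cube F. indicator Q x)"
    proof (rule integral_dominated_convergence[where w = "\<lambda>_. 1"])
      show "AE x in unit_cube F. (\<lambda>N. indicator (S \<beta> N) x :: real) \<longlonglongrightarrow> indicator Q x"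
        using off AE_space by eventually_elim (rule pt)
    qed (auto simp: indicator_def)
    then have "(\<lambda>N. measure (unit_cube F) (S \<beta> N)) \<longlonglongrightarrow> measure (unit_cube F) Q"
      by simp
    then show ?thesis
    proof (rule Lim_transform_eventually)
      show "\<forall>\<^sub>F N in sequentially. measure (unit_cube F) (S \<beta> N)
          = real (card (lattice_points F T C \<beta> N)) / real N ^ card F"
        using eventually_ge_at_top[of 1]
        by eventually_elim (unfold S_def, rule lattice_points_measure[OF F])
    qed
  qed
  then show ?thesis by (rule that)
qed

section \<open>Convergence of the expansion coefficients\<close>

definition block_count :: "nat \<Rightarrow> nat set set \<Rightarrow> (nat set \<Rightarrow> int) \<Rightarrow> nat \<Rightarrow> nat" where
  "block_count n \<rho> m N = card {i \<in> Pi\<^sub>E {1..n} (\<lambda>_. {1..N}). \<forall>B\<in>\<rho>. Eblock n B i = m B}"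

definition block_weight :: "nat \<Rightarrow> nat set set \<Rightarrow> nat \<Rightarrow> (nat set \<Rightarrow> int) \<Rightarrow> real" where
  "block_weight n \<rho> N m = real N powr (real (card \<rho>) - real n - 1) * real (block_count n \<rho> m N)"

text \<open>Extensional functions represent each vector of block sums exactly once.\<close>

definition zero_sum :: "nat set set \<Rightarrow> (nat set \<Rightarrow> int) set" where
  "zero_sum \<rho> = {m \<in> Pi\<^sub>E \<rho> (\<lambda>_. UNIV). (\<Sum>B\<in>\<rho>. m B) = 0}"

text \<open>Restriction to the free coordinates is a bijection whose inverse recomputes the pivots;
  \<open>nat\<close> loses nothing because these values are at least 1.\<close>

lemma card_solutions_eq_lattice_points:
  assumes "F \<union> T = I" "F \<inter> T = {}"
  shows "card {i \<in> Pi\<^sub>E I (\<lambda>_. {1..N}). \<forall>t\<in>T. int (i t) = (\<Sum>f\<in>F. C t f * int (i f)) + \<beta> t}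
    = card (lattice_points F T C \<beta> N)" (is "card ?X = _")
proof -
  define ext where "ext y = (\<lambda>k\<in>I. if k \<in> F then y k else nat ((\<Sum>f\<in>F. C k f * int (y f)) + \<beta> k))" for y :: "nat \<Rightarrow> nat"
  have cong: "(\<Sum>f\<in>F. C t f * int (restrict i F f)) = (\<Sum>f\<in>F. C t f * int (i f))" for t i
    by (intro sum.cong) auto
  have ext_F: "ext y f = y f" if "f \<in> F" for f y
    using that assms by (auto simp: ext_def)
  have ext_T: "ext y t = nat ((\<Sum>f\<in>F. C t f * int (y f)) + \<beta> t)" if "t \<in> T" for t y
    using that assms by (auto simp: ext_def)
  have cong': "(\<Sum>f\<in>F. C t f * int (ext y f)) = (\<Sum>f\<in>F. C t f * int (y f))" for t y
    using ext_F by (intro sum.cong) auto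
  have "bij_betw (\<lambda>i. restrict i F) ?X (lattice_points F T C \<beta> N)"
  proof (rule bij_betw_byWitness[where f' = ext])
    show "\<forall>i\<in>?X. ext (restrict i F) = i"
    proof
      fix i assume i: "i \<in> ?X"
      show "ext (restrict i F) = i"
      proof
        fix k
        consider "k \<in> F" | "k \<in> T" | "k \<notin> I" using assms by blast
        then show "ext (restrict i F) k = i k"
        proof cases
          case 2
          then have "int (i k) = (\<Sum>f\<in>F. C k f * int (i f)) + \<beta> k" using i by blast
          then show ?thesis unfolding ext_T[OF 2] cong by (metis nat_int)
        next
          case 3
          then show ?thesis using i by (auto simp: ext_def PiE_iff extensional_def)
        qed (simp add: ext_F)
      qed
    qed
    show "\<forall>y\<in>lattice_points F T C \<beta> N. restrict (ext y) F = y"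
    proof
      fix y assume "y \<in> lattice_points F T C \<beta> N"
      then have "y \<in> extensional F" by (simp add: lattice_points_def PiE_iff)
      then show "restrict (ext y) F = y"
        by (intro extensionalityI[of _ F]) (auto simp: ext_F)
    qed
    show "(\<lambda>i. restrict i F) ` ?X \<subseteq> lattice_points F T C \<beta> N"
    proof (rule image_subsetI)
      fix i assume i: "i \<in> ?X"
      then have r: "i k \<in> {1..N}" if "k \<in> I" for k using that by blast
      have "(\<Sum>f\<in>F. C t f * int (i f)) + \<beta> t \<in> {1..int N}" if "t \<in> T" for t
      proof -
        have "int (i t) = (\<Sum>f\<in>F. C t f * int (i f)) + \<beta> t" using i that by blast
        moreover have "i t \<in> {1..N}" using r that assms by blast
        ultimately show ?thesis by auto
      qed
      moreover have "restrict i F \<in> Pi\<^sub>E F (\<lambda>_. {1..N})"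
        using r assms by (auto simp: PiE_iff)
      ultimately show "restrict i F \<in> lattice_points F T C \<beta> N"
        unfolding lattice_points_def cong mem_Collect_eq by blast
    qed
    show "ext ` lattice_points F T C \<beta> N \<subseteq> ?X"
    proof (rule image_subsetI)
      fix y assume y: "y \<in> lattice_points F T C \<beta> N"
      have pos: "(\<Sum>f\<in>F. C t f * int (y f)) + \<beta> t \<in> {1..int N}" if "t \<in> T" for t
        using y that by (simp add: lattice_points_def)
      have int_T: "int (ext y t) = (\<Sum>f\<in>F. C t f * int (y f)) + \<beta> t" if "t \<in> T" for t
        unfolding ext_T[OF that] using pos[OF that] by simp
      have "ext y k \<in> {1..N}" if "k \<in> I" for k
      proof (cases "k \<in> F")
        case True
        then have "y k \<in> {1..N}" using y unfolding lattice_points_def by blast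
        then show ?thesis by (simp add: ext_F True)
      next
        case False
        then have k: "k \<in> T" using that assms by blast
        show ?thesis using pos[OF k] int_T[OF k]
          by (simp only: atLeastAtMost_iff) linarith
      qed
      then have "ext y \<in> Pi\<^sub>E I (\<lambda>_. {1..N})" by (auto simp: PiE_iff ext_def)
      then show "ext y \<in> ?X" using int_T by (simp add: cong')
    qed
  qed
  then show ?thesis by (rule bij_betw_same_card)
qed

lemma block_weight_limit:
  assumes n: "n \<ge> 1" and part: "partition_on {1..n} \<rho>"
  obtains \<kappa> where "0 \<le> \<kappa>" "\<kappa> \<le> 1"
    "\<And>m. m \<in> zero_sum \<rho> \<Longrightarrow> (\<lambda>N. block_weight n \<rho> N m) \<longlonglongrightarrow> \<kappa>"
    "\<And>N m. m \<in> zero_sum \<rho> \<Longrightarrow> block_weight n \<rho> N m \<le> 1"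
proof -
  obtain F T :: "nat set" and C :: "nat \<Rightarrow> nat \<Rightarrow> int" where
    FT: "F \<union> T = {1..n}" "F \<inter> T = {}" "Suc (card T) = card \<rho>"
    and rows: "\<forall>t\<in>T. (\<Sum>f\<in>F. C t f) = 1"
    and sol: "\<forall>m. (\<Sum>B\<in>\<rho>. m B) = 0 \<longrightarrow> (\<exists>\<beta>. \<forall>x :: nat \<Rightarrow> int.
       (\<forall>B\<in>\<rho>. (\<Sum>k\<in>B. x (prev_idx n k) - x k) = m B) \<longleftrightarrow> (\<forall>t\<in>T. x t = (\<Sum>f\<in>F. C t f * x f) + \<beta> t))"
    by (rule block_system_solution[OF n part])
  have fin: "finite F" "finite T" using FT(1) by (metis finite_Un finite_atLeastAtMost)+
  have "card F + card T = n"
    using card_Un_disjoint[OF fin FT(2)] FT(1) by simp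
  \<comment> \<open>There are r - 1 pivots, hence n - r + 1 free coordinates: the normalising
    exponent is exactly that of the cube.\<close>
  then have expo: "real (card \<rho>) - real n - 1 = - real (card F)"
    using FT(3) by linarith
  obtain \<kappa> where \<kappa>: "\<And>\<beta>. (\<lambda>N. real (card (lattice_points F T C \<beta> N)) / real N ^ card F) \<longlonglongrightarrow> \<kappa>"
    using lattice_points_density[OF fin] rows by blast
  have weight: "\<exists>\<beta>. \<forall>N\<ge>1. block_weight n \<rho> N m = real (card (lattice_points F T C \<beta> N)) / real N ^ card F"
    if m: "m \<in> zero_sum \<rho>" for m
  proof -
    obtain \<beta> where \<beta>: "\<And>x :: nat \<Rightarrow> int. (\<forall>B\<in>\<rho>. (\<Sum>k\<in>B. x (prev_idx n k) - x k) = m B)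
        \<longleftrightarrow> (\<forall>t\<in>T. x t = (\<Sum>f\<in>F. C t f * x f) + \<beta> t)"
      using sol m unfolding zero_sum_def by blast
    have "block_count n \<rho> m N = card (lattice_points F T C \<beta> N)" for N
      unfolding block_count_def Eblock_def card_solutions_eq_lattice_points[OF FT(1,2), symmetric]
        \<beta>[of "\<lambda>k. int (_ k)"] ..
    moreover have "real N powr - real (card F) = inverse (real N ^ card F)" if "N \<ge> 1" for N
      using that by (simp add: powr_minus powr_realpow)
    ultimately show ?thesis
      unfolding block_weight_def expo by (intro exI[of _ \<beta>]) (simp add: divide_inverse mult.commute)
  qed
  have bound: "real (card (lattice_points F T C \<beta> N)) / real N ^ card F \<le> 1" if "N \<ge> 1" for \<beta> N
  proof -
    have "real (card (lattice_points F T C \<beta> N)) \<le> real (N ^ card F)"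
      unfolding of_nat_le_iff by (rule card_lattice_points_le[OF fin(1)])
    then show ?thesis using that by (simp add: divide_le_eq)
  qed
  show ?thesis
  proof (rule that)
    show "0 \<le> \<kappa>" using \<kappa>[of "\<lambda>_. 0"] by (rule LIMSEQ_le_const) auto
    show "\<kappa> \<le> 1" using \<kappa>[of "\<lambda>_. 0"] by (rule LIMSEQ_le_const2) (use bound in blast)
  next
    fix m assume "m \<in> zero_sum \<rho>"
    then obtain \<beta> where \<beta>: "\<And>N. N \<ge> 1 \<Longrightarrow> block_weight n \<rho> N m = real (card (lattice_points F T C \<beta> N)) / real N ^ card F"
      using weight by blast
    have "\<forall>\<^sub>F N in sequentially. real (card (lattice_points F T C \<beta> N)) / real N ^ card F = block_weight n \<rho> N m"
      using eventually_ge_at_top[of 1] by eventually_elim (simp add: \<beta>)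
    with \<kappa>[of \<beta>] show "(\<lambda>N. block_weight n \<rho> N m) \<longlonglongrightarrow> \<kappa>"
      by (rule Lim_transform_eventually)
    show "block_weight n \<rho> N m \<le> 1" for N
    proof (cases "N = 0")
      \<comment> \<open>The density identity starts at N = 1; here \<open>0 powr _ = 0\<close> makes
        the weight vanish.\<close>
      case True
      then show ?thesis by (simp add: block_weight_def)
    next
      case False
      then show ?thesis using \<beta>[of N] bound[of N \<beta>] by simp
    qed
  qed
qed

text \<open>Formulated for a general \<open>q\<close> and a given \<open>\<kappa>\<close>, so that
  \<open>p\<close> and the uniform density can be treated with the same \<open>\<kappa>\<close> and
  compared.\<close>

lemma KN_tendsto:
  assumes n: "n \<ge> 1" and part: "partition_on {1..n} \<rho>"
    and c: "\<And>m. fcoef q m = complex_of_real (c m)" "\<And>m. 0 \<le> c m"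
    and S: "((\<lambda>m. \<Prod>B\<in>\<rho>. c (m B)) has_sum S) (zero_sum \<rho>)"
    and \<kappa>: "0 \<le> \<kappa>" "\<kappa> \<le> 1"
      "\<And>m. m \<in> zero_sum \<rho> \<Longrightarrow> (\<lambda>N. block_weight n \<rho> N m) \<longlonglongrightarrow> \<kappa>"
      "\<And>N m. m \<in> zero_sum \<rho> \<Longrightarrow> block_weight n \<rho> N m \<le> 1"
  shows "KN q n \<rho> \<longlonglongrightarrow> complex_of_real (\<kappa> * S)"
proof -
  define I where "I N = Pi\<^sub>E {1..n} (\<lambda>_. {1..N})" for N :: nat
  define g where "g i = (\<lambda>B\<in>\<rho>. Eblock n B i)" for i
  define K where "K N = real N powr (real (card \<rho>) - real n - 1) * (\<Sum>i\<in>I N. \<Prod>B\<in>\<rho>. c (Eblock n B i))" for N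
  have finI: "finite (I N)" for N by (simp add: I_def finite_PiE)
  have g_in: "g i \<in> zero_sum \<rho>" for i
    using sum_block_differences_eq_0[OF n part, of "\<lambda>k. int (i k)"]
    by (simp add: g_def zero_sum_def Eblock_def)
  have fibre: "card {i \<in> I N. g i = m} = block_count n \<rho> m N" if "m \<in> zero_sum \<rho>" for m N
  proof -
    have "g i = m \<longleftrightarrow> (\<forall>B\<in>\<rho>. Eblock n B i = m B)" for i
      using that by (auto simp: g_def zero_sum_def PiE_iff fun_eq_iff extensional_def)
    then show ?thesis by (simp add: block_count_def I_def)
  qed
  \<comment> \<open>For fixed N only the finitely many vectors in the image of \<open>g\<close> have
    nonzero weight, so the infinite sum is a regrouped finite one.\<close>
  have sumK: "((\<lambda>m. block_weight n \<rho> N m * (\<Prod>B\<in>\<rho>. c (m B))) has_sum K N) (zero_sum \<rho>)" for N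
  proof (rule has_sum_finite_neutralI[where B = "g ` I N"])
    show "block_weight n \<rho> N m * (\<Prod>B\<in>\<rho>. c (m B)) = 0" if "m \<in> zero_sum \<rho> - g ` I N" for m
    proof -
      have "{i \<in> I N. g i = m} = {}" using that by auto
      then have "block_count n \<rho> m N = 0" using fibre[of m N] that by (metis DiffD1 card.empty)
      then show ?thesis by (simp add: block_weight_def)
    qed
    have "(\<Sum>i\<in>I N. \<Prod>B\<in>\<rho>. c (Eblock n B i)) = (\<Sum>i\<in>I N. \<Prod>B\<in>\<rho>. c (g i B))"
      by (simp add: g_def)
    also have "\<dots> = (\<Sum>m\<in>g ` I N. \<Sum>i\<in>{i \<in> I N. g i = m}. \<Prod>B\<in>\<rho>. c (g i B))"
      by (rule sum.image_gen[OF finI])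
    also have "\<dots> = (\<Sum>m\<in>g ` I N. real (block_count n \<rho> m N) * (\<Prod>B\<in>\<rho>. c (m B)))"
      using fibre g_in by (intro sum.cong) auto
    finally show "K N = (\<Sum>m\<in>g ` I N. block_weight n \<rho> N m * (\<Prod>B\<in>\<rho>. c (m B)))"
      by (simp add: K_def block_weight_def sum_distrib_left mult.assoc)
  qed (use finI g_in in auto)
  have "K \<longlonglongrightarrow> \<kappa> * S"
    by (rule has_sum_weighted_limit[OF _ S _ _ \<kappa>(3,1,2) sumK])
      (auto simp: c prod_nonneg block_weight_def[of n \<rho> _ _] intro: \<kappa>(4)[unfolded block_weight_def])
  then have "(\<lambda>N. complex_of_real (K N)) \<longlonglongrightarrow> complex_of_real (\<kappa> * S)"
    by (rule tendsto_of_real)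
  moreover have "KN q n \<rho> = (\<lambda>N. complex_of_real (K N))"
    by (simp add: fun_eq_iff KN_def K_def I_def c)
  ultimately show ?thesis by simp
qed

section \<open>Fourier coefficients of the density, its powers and the uniform density\<close>

lemma fcoef_eq_fourier: "fcoef p m = fourier (\<lambda>x. complex_of_real (p x)) m"
  by (simp add: fcoef_def fourier_def set_lebesgue_integral_period)

text \<open>Parseval makes the coefficients of p^(k+1) limits of convolutions of those of p and p^k.
  Reality and nonnegativity therefore propagate by induction, and they in turn make the convolution
  an unconditional sum.\<close>

lemma fourier_powers:
  fixes p :: "real \<Rightarrow> real"
  assumes meas: "p \<in> borel_measurable borel" and nonneg: "\<And>x. x \<in> {-pi..pi} \<Longrightarrow> 0 \<le> p x"
    and powers: "\<And>k. integrable period (\<lambda>x. p x ^ k)"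
    and coeff: "\<And>m. 0 \<le> fourier (\<lambda>x. complex_of_real (p x)) m"
  defines "\<alpha> \<equiv> \<lambda>k m. Re (fourier (\<lambda>x. complex_of_real (p x ^ k)) m)"
  shows "fourier (\<lambda>x. complex_of_real (p x ^ k)) m = complex_of_real (\<alpha> k m)"
    and "0 \<le> \<alpha> k m"
    and "((\<lambda>j. \<alpha> 1 j * \<alpha> k (m - j)) has_sum 2 * pi * \<alpha> (Suc k) m) UNIV"
proof -
  define P where "P k x = complex_of_real (p x ^ k)" for k x
  have sq: "square_integrable (P k)" for k
  proof -
    have "(\<lambda>x. P k x) \<in> borel_measurable period"
      using borel_measurable_period[OF meas] by (simp add: P_def)
    moreover have "(norm (P k x))\<^sup>2 = p x ^ (2 * k)" for x
      unfolding P_def norm_of_real power2_abs by (simp add: power_mult[symmetric] mult.commute)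
    ultimately show ?thesis using powers[of "2 * k"] by (simp add: square_integrable_def)
  qed
  have conv: "(\<lambda>M. \<Sum>j\<in>{-int M..int M}. fourier (P 1) j * fourier (P k) (s - j))
      \<longlonglongrightarrow> 2 * complex_of_real pi * fourier (P (Suc k)) s" for k s
  proof -
    \<comment> \<open>The character shifts the coefficients by s, so the index -j of the pairing
      reads off the coefficient s - j of p^k.\<close>
    define h where "h x = cis (real_of_int s * x) * P k x" for x
    have h: "square_integrable h"
      unfolding h_def by (intro square_integrable_cis_mult sq)
    have "parseval h (\<lambda>x. complex_of_real (p x))"
      using sq[of 1] by (intro parseval_nonneg h meas nonneg) (simp_all add: P_def[abs_def])
    then have "fourier_pairing h (P 1) \<longlonglongrightarrow> 2 * complex_of_real pi * (LINT x|period. P 1 x * h x)"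
      by (simp add: parseval_def P_def[abs_def])
    moreover have "(LINT x|period. P 1 x * h x) = fourier (P (Suc k)) s"
      unfolding fourier_def h_def P_def by (intro Bochner_Integration.integral_cong) (simp_all add: mult_ac)
    moreover have "fourier h (-j) = fourier (P k) (s - j)" for j
      unfolding h_def fourier_cis_mult by simp
    then have "fourier_pairing h (P 1) = (\<lambda>M. \<Sum>j\<in>{-int M..int M}. fourier (P 1) j * fourier (P k) (s - j))"
      by (simp add: fun_eq_iff fourier_pairing_def)
    ultimately show ?thesis by simp
  qed
  have \<alpha>: "\<alpha> k m = Re (fourier (P k) m)" for k m by (simp add: \<alpha>_def P_def[abs_def])
  \<comment> \<open>In the order on complex numbers, 0 \<le> z includes that z is real.\<close>
  have P1: "fourier (P 1) m = complex_of_real (\<alpha> 1 m) \<and> 0 \<le> \<alpha> 1 m" for m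
    using coeff[of m] by (simp add: \<alpha> P_def[abs_def] less_eq_complex_def complex_eq_iff)
  have lim: "(\<lambda>M. complex_of_real (\<Sum>j\<in>{-int M..int M}. \<alpha> 1 j * \<alpha> k (s - j)))
      \<longlonglongrightarrow> 2 * complex_of_real pi * fourier (P (Suc k)) s"
    if "\<And>m. fourier (P k) m = complex_of_real (\<alpha> k m)" for k s
    using conv[of k s] unfolding that P1[THEN conjunct1] by simp
  have main: "fourier (P k) m = complex_of_real (\<alpha> k m) \<and> 0 \<le> \<alpha> k m" for k m
  proof (induction k arbitrary: m)
    case 0
    have "fourier (P 0) m = complex_of_real (if m = 0 then 2 * pi else 0)"
      using fourier_cis[of 0 m] by (simp add: P_def[abs_def])
    then show ?case unfolding \<alpha> by simp
  next
    case (Suc k)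
    note l = lim[of k m, OF conjunct1[OF Suc.IH]]
    have "(\<lambda>M. 0) \<longlonglongrightarrow> Im (2 * complex_of_real pi * fourier (P (Suc k)) m)"
      using tendsto_Im[OF l] by simp
    then have "Im (fourier (P (Suc k)) m) = 0"
      by (simp add: LIMSEQ_const_iff)
    moreover have "0 \<le> Re (2 * complex_of_real pi * fourier (P (Suc k)) m)"
      by (rule LIMSEQ_le_const[OF tendsto_Re[OF l]])
        (use Suc.IH P1 in \<open>auto intro!: sum_nonneg\<close>)
    ultimately show ?case
      using pi_gt_zero by (auto simp: \<alpha> complex_eq_iff zero_le_mult_iff)
  qed
  show "fourier (\<lambda>x. complex_of_real (p x ^ k)) m = complex_of_real (\<alpha> k m)" "0 \<le> \<alpha> k m"
    using main[of k m] by (auto simp: P_def[abs_def])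
  show "((\<lambda>j. \<alpha> 1 j * \<alpha> k (m - j)) has_sum 2 * pi * \<alpha> (Suc k) m) UNIV"
  proof (rule has_sum_int_symmetric)
    show "0 \<le> \<alpha> 1 j * \<alpha> k (m - j)" for j using main by simp
    show "(\<lambda>M. \<Sum>j\<in>{-int M..int M}. \<alpha> 1 j * \<alpha> k (m - j)) \<longlonglongrightarrow> 2 * pi * \<alpha> (Suc k) m"
      using tendsto_Re[OF lim[of k m, OF conjunct1[OF main]]] by (simp add: \<alpha>)
  qed
qed

lemma fcoef_unif_density: "fcoef unif_density m = complex_of_real (of_bool (m = 0))"
proof -
  have "fcoef unif_density m = complex_of_real (1 / (2 * pi)) * fourier (\<lambda>x. cis (real_of_int 0 * x)) m"
    by (simp add: fcoef_def fourier_def set_lebesgue_integral_period unif_density_def mult.commute)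
  also have "\<dots> = complex_of_real (of_bool (m = 0))"
    unfolding fourier_cis by simp
  finally show ?thesis .
qed

text \<open>For the uniform law only the zero vector contributes. With total 1, the limit of its
  coefficients is \<open>\<kappa>\<close> itself.\<close>

lemma has_sum_zero_sum_delta:
  assumes "finite \<rho>"
  shows "((\<lambda>m. \<Prod>B\<in>\<rho>. of_bool (m B = 0)) has_sum (1 :: real)) (zero_sum \<rho>)"
proof (rule has_sum_finite_neutralI[where B = "{\<lambda>B\<in>\<rho>. 0}"])
  show "{\<lambda>B\<in>\<rho>. 0} \<subseteq> zero_sum \<rho>" by (simp add: zero_sum_def)
  show "(\<Prod>B\<in>\<rho>. of_bool (m B = 0)) = (0 :: real)" if m: "m \<in> zero_sum \<rho> - {\<lambda>B\<in>\<rho>. 0}" for m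
  proof -
    obtain B where "B \<in> \<rho>" "m B \<noteq> 0"
      using m by (auto simp: zero_sum_def PiE_iff extensional_def fun_eq_iff split: if_splits)
    then show ?thesis using assms by (intro prod_zero) auto
  qed
qed auto

theorem theorem1:
  fixes p :: "real \<Rightarrow> real" and n :: nat and \<rho> :: "nat set set"
  assumes p_meas: "p \<in> borel_measurable lborel"
    and p_nonneg: "\<And>x. x \<in> {-pi..pi} \<Longrightarrow> 0 \<le> p x"
    and p_prob: "(LINT x:{-pi..pi}|lborel. p x) = 1"
    and p_L: "\<And>q::real. q \<ge> 1 \<Longrightarrow> set_integrable lborel {-pi..pi} (\<lambda>x. \<bar>p x\<bar> powr q)"
    and p_A: "\<And>m::int. 0 \<le> (LINT t:{-pi..pi}|lborel. cis (- (real_of_int m * t)) * complex_of_real (p t))"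
    and n_pos: "n \<ge> 1"
    and part: "partition_on {1..n} \<rho>"
  shows "convergent (KN unif_density n \<rho>) \<and>
         KN p n \<rho> \<longlonglongrightarrow>
           lim (KN unif_density n \<rho>) * complex_of_real ((2 * pi) ^ (card \<rho> - 1)) *
           complex_of_real (LINT x:{-pi..pi}|lborel. p x ^ card \<rho>)"
proof -
  have meas: "p \<in> borel_measurable borel" using p_meas by simp
  have fin: "finite \<rho>" using part finite_elements by blast
  have "\<rho> \<noteq> {}" using partition_onD1[OF part] n_pos by auto
  then have r: "card \<rho> \<ge> 1" using fin by (simp add: Suc_le_eq card_gt_0_iff)
  have powers: "integrable period (\<lambda>x. p x ^ k)" for k
  proof (cases "k = 0")
    case True
    then show ?thesis using integrable_period_bounded[of "\<lambda>_. 1::real" 1] by simp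
  next
    \<comment> \<open>A positive exponent is needed both for the integrability hypothesis and for
      \<open>powr\<close> to agree with the power where p x = 0.\<close>
    case False
    then have "integrable period (\<lambda>x. \<bar>p x\<bar> powr real k)"
      using p_L[of "real k"] by (simp add: set_integrable_period)
    moreover have "integrable period (\<lambda>x. \<bar>p x\<bar> powr real k) \<longleftrightarrow> integrable period (\<lambda>x. p x ^ k)"
    proof (intro Bochner_Integration.integrable_cong refl)
      show "\<bar>p x\<bar> powr real k = p x ^ k" if "x \<in> space period" for x
        using p_nonneg[of x] that False by (simp add: powr_realpow')
    qed
    ultimately show ?thesis by simp
  qed
  \<comment> \<open>The class condition uses e^(-imt), the coefficients e^(imt); it holds for all
    integers m, so m may be negated.\<close>
  have coeff: "0 \<le> fourier (\<lambda>x. complex_of_real (p x)) m" for m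
    using p_A[of "-m"] by (simp add: fourier_def set_lebesgue_integral_period)
  define \<alpha> where "\<alpha> k m = Re (fourier (\<lambda>x. complex_of_real (p x ^ k)) m)" for k m
  note \<alpha> = fourier_powers[OF meas p_nonneg powers coeff, folded \<alpha>_def]
  \<comment> \<open>The zeroth power is the constant 1, also where p x = 0; its coefficients start
    the convolution recursion.\<close>
  have zero: "\<alpha> 0 m = (if m = 0 then 2 * pi else 0)" for m
    using fourier_cis[of 0 m] by (simp add: \<alpha>_def)
  have sum_p: "((\<lambda>m. \<Prod>B\<in>\<rho>. \<alpha> 1 (m B)) has_sum (2 * pi) ^ card \<rho> / (2 * pi) * \<alpha> (card \<rho>) 0) (zero_sum \<rho>)"
    unfolding zero_sum_def
    by (rule has_sum_prod_convolution[OF \<alpha>(2) zero _ \<alpha>(3) fin]) simp_all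
  have \<alpha>r: "\<alpha> (card \<rho>) 0 = (LINT x:{-pi..pi}|lborel. p x ^ card \<rho>)"
    by (simp add: \<alpha>_def fourier_def set_lebesgue_integral_period flip: of_real_power)
  have pow: "(2 * pi) ^ card \<rho> / (2 * pi) = (2 * pi) ^ (card \<rho> - 1)"
    using r by (simp add: power_diff)
  obtain \<kappa> where \<kappa>: "0 \<le> \<kappa>" "\<kappa> \<le> 1"
    "\<And>m. m \<in> zero_sum \<rho> \<Longrightarrow> (\<lambda>N. block_weight n \<rho> N m) \<longlonglongrightarrow> \<kappa>"
    "\<And>N m. m \<in> zero_sum \<rho> \<Longrightarrow> block_weight n \<rho> N m \<le> 1"
    using block_weight_limit[OF n_pos part] by blast
  have unif: "KN unif_density n \<rho> \<longlonglongrightarrow> complex_of_real \<kappa>"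
    using KN_tendsto[OF n_pos part fcoef_unif_density _ has_sum_zero_sum_delta[OF fin] \<kappa>] by simp
  have "fcoef p m = complex_of_real (\<alpha> 1 m)" for m
    using \<alpha>(1)[of 1 m] by (simp add: fcoef_eq_fourier)
  from KN_tendsto[OF n_pos part this \<alpha>(2) sum_p \<kappa>]
  have "KN p n \<rho> \<longlonglongrightarrow> complex_of_real (\<kappa> * ((2 * pi) ^ (card \<rho> - 1) * (LINT x:{-pi..pi}|lborel. p x ^ card \<rho>)))"
    unfolding pow \<alpha>r .
  with unif show ?thesis
    by (auto simp: convergent_def limI mult.assoc)
qed

end
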